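(* Let $d$ be a positive integer and let $\Lambda=(\lambda_n)_n$ be a random sequence in $\mathbb{D}^d$ with prescribed radii $(r_n)_n$ and counting function $(N_m)_{m\in\mathbb{N}^d}$. If there exist $\varepsilon>0$ and $C>0$ such that $N_m\le C\,2^{(1-\varepsilon)|m|}$ for all $m\in\mathbb{N}^d$, then $$\mathbb{P}\left(\Lambda \text{ is a Carleson sequence for } H^2_d\right)=1.$$ Otherwise (that is, if no such $\varepsilon, C>0$ exist), $$\mathbb{P}\left(\Lambda \text{ is a Carleson sequence for } H^2_d\right)=0.$$
   Context: Conventions: $\mathbb{N}=\{0,1,2,\dots\}$; for $m=(m_1,\dots,m_d)\in\mathbb{N}^d$, $|m|=m_1+\dots+m_d$. $\mathbb{D}^d=\{z=(z^1,\dots,z^d)\in\mathbb{C}^d : |z^i|<1,\ i=1,\dots,d\}$ (superscripts denote coordinates). Hardy space: $H^2_d$ is the reproducing kernel Hilbert space of analytic functions on $\mathbb{D}^d$ with kernel $s(z,w)=s_w(z)=\prod_{i=1}^d \frac{1}{1-\overline{w^i}z^i}$. Carleson sequence: a sequence $Z=(z_n)_n$ in $\mathbb{D}^d$ is a Carleson sequence for $H^2_d$ if the measure $\mu_Z=\sum_n \|s_{z_n}\|^{-2}\delta_{z_n}$ is a Carleson measure for $H^2_d$, i.e. there is a constant $C_Z$ with $\|f\|_{L^2(\mathbb{D}^d,\mu_Z)}\le C_Z\|f\|_{H^2_d}$ for all $f\in H^2_d$; here $\|s_{z}\|^{-2}=\prod_{i=1}^d(1-|z^i|^2)$. Random sequence: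 let $(r_n)_{n\in\mathbb{N}}$ be a deterministic sequence in $(0,1)^d$, $r_n=(r_n^1,\dots,r_n^d)$, and let $\theta_n=(\theta_n^1,\dots,\theta_n^d)$, $n\in\mathbb{N}$, be i.i.d. random variables on a probability space $(\Omega,\mathcal{A},\mathbb{P})$, uniformly distributed on the $d$-dimensional torus (identified with $[0,1)^d$). The random sequence is $\Lambda=(\lambda_n)_{n\in\mathbb{N}}$ with $\lambda_n=(r_n^1e^{2\pi i\theta_n^1},\dots,r_n^de^{2\pi i\theta_n^d})$. Counting function: for $m\in\mathbb{N}^d$ let $A_m=\{z\in\mathbb{D}^d : 2^{-(m_i+1)}\le 1-|z^i|<2^{-m_i},\ i=1,\dots,d\}$, and let $N_m\in\mathbb{N}\cup\{\infty\}$ be the (deterministic) number of indices $n$ with $\lambda_n\in A_m$. *)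

theory Defs
  imports "HOL-Probability.Probability"
begin

section \<open>Reproducing kernel Hilbert spaces of complex functions\<close>

definition ip_norm :: "(('a \<Rightarrow> complex) \<Rightarrow> ('a \<Rightarrow> complex) \<Rightarrow> complex) \<Rightarrow> ('a \<Rightarrow> complex) \<Rightarrow> real"
  where "ip_norm ip f = sqrt (Re (ip f f))"

text \<open>Functions on \<open>X\<close> are represented by total functions that vanish outside \<open>X\<close>,
  so that equality of functions on \<open>X\<close> is plain equality.\<close>

definition kernel_fun :: "'a set \<Rightarrow> ('a \<Rightarrow> 'a \<Rightarrow> complex) \<Rightarrow> 'a \<Rightarrow> 'a \<Rightarrow> complex"
  where "kernel_fun X K w = (\<lambda>z. if z \<in> X then K z w else 0)"

text \<open>\<open>H\<close> with inner product \<open>ip\<close> (linear in the first argument) is the reproducing kernel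
  Hilbert space on \<open>X\<close> with kernel \<open>K\<close>. By the Moore--Aronszajn theorem these axioms
  determine \<open>H\<close>, and \<open>ip\<close> on \<open>H\<close>, uniquely from \<open>X\<close> and \<open>K\<close>.\<close>

locale rkhs =
  fixes X :: "'a set"
    and K :: "'a \<Rightarrow> 'a \<Rightarrow> complex"
    and H :: "('a \<Rightarrow> complex) set"
    and ip :: "('a \<Rightarrow> complex) \<Rightarrow> ('a \<Rightarrow> complex) \<Rightarrow> complex"
  assumes support: "f \<in> H \<Longrightarrow> x \<notin> X \<Longrightarrow> f x = 0"
    and zero_mem: "(\<lambda>x. 0) \<in> H"
    and add_mem: "f \<in> H \<Longrightarrow> g \<in> H \<Longrightarrow> (\<lambda>x. f x + g x) \<in> H"
    and scale_mem: "f \<in> H \<Longrightarrow> (\<lambda>x. c * f x) \<in> H"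
    and ip_add: "f \<in> H \<Longrightarrow> g \<in> H \<Longrightarrow> h \<in> H \<Longrightarrow> ip (\<lambda>x. f x + g x) h = ip f h + ip g h"
    and ip_scale: "f \<in> H \<Longrightarrow> h \<in> H \<Longrightarrow> ip (\<lambda>x. c * f x) h = c * ip f h"
    and ip_cnj: "f \<in> H \<Longrightarrow> g \<in> H \<Longrightarrow> ip g f = cnj (ip f g)"
    and ip_pos: "f \<in> H \<Longrightarrow> f \<noteq> (\<lambda>x. 0) \<Longrightarrow> Re (ip f f) > 0"
    and complete:
      "\<lbrakk>\<And>n. F n \<in> H;
        \<And>e. e > 0 \<Longrightarrow> \<exists>n0. \<forall>m\<ge>n0. \<forall>n\<ge>n0. ip_norm ip (\<lambda>x. F m x - F n x) < e\<rbrakk>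
       \<Longrightarrow> \<exists>f\<in>H. (\<lambda>n. ip_norm ip (\<lambda>x. F n x - f x)) \<longlonglongrightarrow> 0"
    and kernel_mem: "w \<in> X \<Longrightarrow> kernel_fun X K w \<in> H"
    and reproducing: "f \<in> H \<Longrightarrow> w \<in> X \<Longrightarrow> f w = ip f (kernel_fun X K w)"

section \<open>The Hardy space on the polydisc\<close>

definition polydisc :: "(complex ^ 'd) set"
  where "polydisc = {z. \<forall>i. cmod (z $ i) < 1}"

definition szego :: "complex ^ 'd \<Rightarrow> complex ^ 'd \<Rightarrow> complex"
  where "szego z w = (\<Prod>i\<in>UNIV. 1 / (1 - cnj (w $ i) * z $ i))"

text \<open>Analyticity in several variables: Frechet differentiability with complex-linear
  derivative at every point (the domain is meant to be open).\<close>

definition analytic_sv :: "(complex ^ 'd \<Rightarrow> complex) \<Rightarrow> (complex ^ 'd) set \<Rightarrow> bool"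
  where "analytic_sv f S \<longleftrightarrow>
    (\<forall>z\<in>S. \<exists>D. (f has_derivative D) (at z) \<and> (\<forall>c v. D (c *s v) = c * D v))"

locale hardy_space =
  rkhs "polydisc :: (complex ^ 'd) set" szego H ip
  for H :: "(complex ^ 'd \<Rightarrow> complex) set"
    and ip :: "(complex ^ 'd \<Rightarrow> complex) \<Rightarrow> (complex ^ 'd \<Rightarrow> complex) \<Rightarrow> complex" +
  assumes analytic: "f \<in> H \<Longrightarrow> analytic_sv f polydisc"

section \<open>Carleson measures and Carleson sequences\<close>

text \<open>The embedding inequality is stated in squared form with values in \<open>[0, \<infinity>]\<close>; as elements of
  \<open>H\<close> vanish outside the polydisc, the integral is over the polydisc.\<close>

definition carleson_measure ::
  "(complex ^ 'd \<Rightarrow> complex) set \<Rightarrow> ((complex ^ 'd \<Rightarrow> complex) \<Rightarrow> (complex ^ 'd \<Rightarrow> complex) \<Rightarrow> complex)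
    \<Rightarrow> (complex ^ 'd) measure \<Rightarrow> bool"
  where "carleson_measure H ip \<mu> \<longleftrightarrow>
    (\<exists>C\<ge>0. \<forall>f\<in>H. (\<integral>\<^sup>+ z. ennreal ((cmod (f z))\<^sup>2) \<partial>\<mu>) \<le> ennreal ((C * ip_norm ip f)\<^sup>2))"

text \<open>The sum over \<open>n\<close> of the point masses at \<open>z n\<close> with weight \<open>1 / \<parallel>s\<^sub>z\<parallel>\<^sup>2\<close>,
  obtained by pushing the weighted counting measure on the indices forward along \<open>z\<close>.\<close>

definition seq_measure ::
  "((complex ^ 'd \<Rightarrow> complex) \<Rightarrow> (complex ^ 'd \<Rightarrow> complex) \<Rightarrow> complex)
    \<Rightarrow> (nat \<Rightarrow> complex ^ 'd) \<Rightarrow> (complex ^ 'd) measure"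
  where "seq_measure ip z =
    distr (density (count_space UNIV)
             (\<lambda>n. ennreal (1 / (ip_norm ip (kernel_fun polydisc szego (z n)))\<^sup>2)))
          borel z"

definition carleson_sequence ::
  "(complex ^ 'd \<Rightarrow> complex) set \<Rightarrow> ((complex ^ 'd \<Rightarrow> complex) \<Rightarrow> (complex ^ 'd \<Rightarrow> complex) \<Rightarrow> complex)
    \<Rightarrow> (nat \<Rightarrow> complex ^ 'd) \<Rightarrow> bool"
  where "carleson_sequence H ip z \<longleftrightarrow>
    (\<forall>n. z n \<in> polydisc) \<and> carleson_measure H ip (seq_measure ip z)"

text \<open>The formula for \<open>1 / \<parallel>s\<^sub>z\<parallel>\<^sup>2\<close> in terms of the coordinates.\<close>

lemma (in hardy_space) kernel_norm_sq:
  assumes "z \<in> polydisc"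
  shows "1 / (ip_norm ip (kernel_fun polydisc szego z))\<^sup>2 = (\<Prod>i\<in>UNIV. 1 - (cmod (z $ i))\<^sup>2)"
proof -
  have lt: "(cmod (z $ i))\<^sup>2 < 1" for i
    using assms by (simp add: polydisc_def abs_square_less_1)
  have "ip (kernel_fun polydisc szego z) (kernel_fun polydisc szego z) = szego z z"
    using reproducing[OF kernel_mem[OF assms] assms] assms by (simp add: kernel_fun_def)
  also have "\<dots> = of_real (\<Prod>i\<in>UNIV. 1 / (1 - (cmod (z $ i))\<^sup>2))"
    by (simp add: szego_def mult.commute flip: complex_norm_square)
  finally have "(ip_norm ip (kernel_fun polydisc szego z))\<^sup>2 = (\<Prod>i\<in>UNIV. 1 / (1 - (cmod (z $ i))\<^sup>2))"
    using lt by (simp add: ip_norm_def prod_nonneg less_imp_le del: of_real_prod)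
  then show ?thesis
    by (simp add: prod_dividef)
qed

section \<open>Random sequences and their counting functions\<close>

definition unit_cube :: "(real ^ 'd) set"
  where "unit_cube = {x. \<forall>i. 0 \<le> x $ i \<and> x $ i < 1}"

definition random_seq ::
  "(nat \<Rightarrow> real ^ 'd) \<Rightarrow> (nat \<Rightarrow> 'w \<Rightarrow> real ^ 'd) \<Rightarrow> 'w \<Rightarrow> nat \<Rightarrow> complex ^ 'd"
  where "random_seq r \<theta> \<omega> n =
    (\<chi> i. complex_of_real (r n $ i) * exp (2 * complex_of_real pi * \<i> * complex_of_real (\<theta> n \<omega> $ i)))"

definition multi_abs :: "nat ^ 'd \<Rightarrow> nat"
  where "multi_abs m = (\<Sum>i\<in>UNIV. m $ i)"

definition dyadic_annulus :: "nat ^ 'd \<Rightarrow> (complex ^ 'd) set"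
  where "dyadic_annulus m = {z \<in> polydisc. \<forall>i.
    1 / 2 ^ (m $ i + 1) \<le> 1 - cmod (z $ i) \<and> 1 - cmod (z $ i) < 1 / 2 ^ (m $ i)}"

definition index_count :: "(nat \<Rightarrow> complex ^ 'd) \<Rightarrow> nat ^ 'd \<Rightarrow> enat"
  where "index_count z m =
    (let A = {n. z n \<in> dyadic_annulus m} in if finite A then enat (card A) else \<infinity>)"

text \<open>The counting function of a random sequence depends on the radii only.\<close>

lemma index_count_random_seq:
  "index_count (random_seq r \<theta> \<omega>) m = index_count (\<lambda>n. \<chi> i. complex_of_real (r n $ i)) m"
  by (simp add: index_count_def dyadic_annulus_def polydisc_def random_seq_def norm_mult)

end

theory Submission
  imports Defs "HOL-Real_Asymp.Real_Asymp"
begin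

text \<open>Let \<open>\<mu>\<close> be the measure of the sequence \<open>z\<close>, with mass \<open>\<Prod>i. 1 - \<bar>z n i\<bar>\<^sup>2\<close> at \<open>z n\<close>, and let a
  point of the annulus \<open>A\<^sub>m\<close> be said to have level \<open>m\<close>. The torus splits into \<open>2 ^ \<bar>m\<bar>\<close> boxes with
  sides \<open>1 / 2 ^ m i\<close>. The growth condition bounds the number of points of level \<open>m\<close> by a
  constant times the number of these boxes to some power below one: it saves a power.

  \<^bold>\<open>The growth condition implies the Carleson property.\<close> By duality the embedding is bounded if
  and only if the matrix of the Szego kernel \<open>s (z p) (z q)\<close> is bounded on \<open>\<ell>\<^sup>2(\<mu>)\<close>. The Schur
  test with absolute values suffices for this, provided that the test vector is chosen well: the
  constant vector fails, since each of the levels below the level of \<open>z p\<close> may contribute an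
  amount of order one to the row of \<open>p\<close>. For the vector \<open>2 powr (\<eta> * \<bar>lev n\<bar>)\<close> with a
  small \<open>\<eta> > 0\<close>, the interaction of the levels \<open>l\<close> and \<open>m\<close> decays geometrically in each
  \<open>\<bar>l i - m i\<bar>\<close>, and the power saving pays for the growth of the vector. The sums over
  points of one level are controlled by the numbers of points in boxes of all sizes.
  It is enough that a box holds at most a constant number of points of level \<open>l\<close>, or a constant
  times their mean number with a part of the power saving given away: this is
  \<open>carleson_sequence_if_sparse\<close>. Independent uniform angles have this property almost surely, by an
  exponential moment estimate whose parameter grows linearly with the level, so that it
  outweighs the number of boxes; this is \<open>AE_count_near_le\<close>.

  \<^bold>\<open>Failure of the growth condition excludes the Carleson property.\<close> Fix \<open>k\<close>. There are levels \<open>m\<close>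
  with more than \<open>c * 2 powr ((1 - 1 / (2 * k)) * \<bar>m\<bar>)\<close> points, for \<open>c\<close> as large as desired. Such
  points fall independently into \<open>2 ^ \<bar>m\<bar>\<close> boxes, and the probability that no box receives \<open>k\<close> of
  them is arbitrarily small (\<open>exists_subset_few_small_fibre_maps\<close> and \<open>prob_no_crowded_cell_le\<close>). On the other
  hand, an embedding with constant \<open>C\<close>, tested on the kernel function at one of the points of a box,
  allows at most a fixed multiple of \<open>C\<close> points of level \<open>m\<close> in the box
  (\<open>card_cell_le_if_embedding\<close>). So every \<open>C\<close> is an embedding constant with probability zero,
  and the Carleson event is the union of these events over the natural numbers \<open>C\<close>.

  \<^bold>\<open>Measurability.\<close> For fixed \<open>C\<close>, the embedding inequality is a closed condition on the angles,
  because the radii are fixed and the elements of the Hardy space are continuous.\<close>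

section \<open>A Schur test for reproducing kernels\<close>

context rkhs
begin

lemma ip_norm_sq: "f \<in> H \<Longrightarrow> (ip_norm ip f)\<^sup>2 = Re (ip f f)"
proof -
  assume f: "f \<in> H"
  have "Re (ip f f) \<ge> 0"
  proof (cases "f = (\<lambda>x. 0)")
    case True
    then show ?thesis using ip_scale[OF f f, of 0] by simp
  next
    case False
    then show ?thesis using ip_pos[OF f] by simp
  qed
  then show ?thesis by (simp add: ip_norm_def)
qed

lemma sum_mem_and_ip_sum:
  assumes "finite F" "\<And>n. n \<in> F \<Longrightarrow> g n \<in> H"
  shows "(\<lambda>x. \<Sum>n\<in>F. c n * g n x) \<in> H \<and>
    (\<forall>h\<in>H. ip (\<lambda>x. \<Sum>n\<in>F. c n * g n x) h = (\<Sum>n\<in>F. c n * ip (g n) h))"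
  using assms
proof (induction F rule: finite_induct)
  case empty
  have "ip (\<lambda>x. 0) h = 0" if "h \<in> H" for h
    using ip_scale[OF zero_mem that, of 0] by simp
  then show ?case using zero_mem by simp
next
  case (insert a F)
  then have IH: "(\<lambda>x. \<Sum>n\<in>F. c n * g n x) \<in> H"
      "\<And>h. h \<in> H \<Longrightarrow> ip (\<lambda>x. \<Sum>n\<in>F. c n * g n x) h = (\<Sum>n\<in>F. c n * ip (g n) h)"
    and a: "g a \<in> H" by auto
  note sc = scale_mem[OF a, of "c a"]
  show ?case
    using insert.hyps add_mem[OF sc IH(1)] ip_add[OF sc IH(1)] ip_scale[OF a] IH(2)
    by auto
qed

lemma kernel_hermitian:
  assumes "z \<in> X" "w \<in> X"
  shows "K w z = cnj (K z w)"
  using reproducing[OF kernel_mem[OF assms(1)] assms(2)]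
    reproducing[OF kernel_mem[OF assms(2)] assms(1)]
    ip_cnj[OF kernel_mem[OF assms(1)] kernel_mem[OF assms(2)]] assms
  by (simp add: kernel_fun_def)

text \<open>Let \<open>T\<close> be the restriction \<open>f \<mapsto> (f (z n))\<^sub>n\<close> into \<open>\<ell>\<^sup>2(\<mu>)\<close>. Its adjoint sends \<open>c\<close> to
  the sum of the functions \<open>\<mu> n * c n * K (\<cdot>, z n)\<close>, so \<open>T T\<^sup>*\<close> is the integral operator on
  \<open>\<ell>\<^sup>2(\<mu>)\<close> with kernel \<open>K (z p) (z q)\<close>, whose norm is at most \<open>B\<close> by the Schur test with the
  vector \<open>v\<close>. In the proof, \<open>g\<close> is \<open>T\<^sup>* T f\<close>, and the inequality \<open>0 \<le> \<parallel>f - g / B\<parallel>\<^sup>2\<close> carries the bound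
  over from \<open>T\<^sup>*\<close> to \<open>T\<close>.\<close>

lemma schur_test:
  assumes F: "finite F" and z: "\<And>n. n \<in> F \<Longrightarrow> z n \<in> X"
    and mu: "\<And>n. n \<in> F \<Longrightarrow> \<mu> n \<ge> 0" and v: "\<And>n. n \<in> F \<Longrightarrow> v n > 0"
    and B: "B > 0"
    and row: "\<And>p. p \<in> F \<Longrightarrow> (\<Sum>q\<in>F. \<mu> q * cmod (K (z p) (z q)) * v q) \<le> B * v p"
    and f: "f \<in> H"
  shows "(\<Sum>n\<in>F. \<mu> n * (cmod (f (z n)))\<^sup>2) \<le> B * (ip_norm ip f)\<^sup>2"
proof -
  define k where "k n = kernel_fun X K (z n)" for n
  define c where "c n = complex_of_real (\<mu> n) * f (z n)" for n
  define g where "g = (\<lambda>x. \<Sum>n\<in>F. c n * k n x)"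
  define S where "S = (\<Sum>n\<in>F. \<mu> n * (cmod (f (z n)))\<^sup>2)"
  have k: "k n \<in> H" if "n \<in> F" for n using kernel_mem z that by (simp add: k_def)
  have gH: "g \<in> H" and ipg: "ip g h = (\<Sum>n\<in>F. c n * ip (k n) h)" if "h \<in> H" for h
    using sum_mem_and_ip_sum[OF F, of k c] k zero_mem that by (auto simp: g_def)
  have gH: "g \<in> H" using gH[OF zero_mem] .
  have ipk: "ip (k n) h = cnj (h (z n))" if "h \<in> H" "n \<in> F" for h n
    using reproducing[OF that(1) z[OF that(2)]] ip_cnj[OF that(1) k[OF that(2)]]
    by (simp add: k_def)
  have gf: "ip g f = of_real S"
    unfolding ipg[OF f] S_def c_def of_real_sum
    by (intro sum.cong) (auto simp: ipk[OF f] complex_norm_square simp del: of_real_power)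
  have fg: "ip f g = of_real S"
    using ip_cnj[OF gH f] gf by simp
  have gz: "g (z p) = (\<Sum>q\<in>F. c q * K (z p) (z q))" if "p \<in> F" for p
    using z[OF that] by (simp add: g_def k_def kernel_fun_def)
  let ?y = "\<lambda>n. cmod (f (z n))"
  let ?A = "\<lambda>p q. \<mu> p * \<mu> q * cmod (K (z p) (z q))"
  have sym: "cmod (K (z p) (z q)) = cmod (K (z q) (z p))" if "p \<in> F" "q \<in> F" for p q
    using kernel_hermitian[OF z[OF that(1)] z[OF that(2)]] by simp
  have "Re (ip g g) \<le> cmod (ip g g)" by (rule complex_Re_le_cmod)
  also have ggs: "ip g g = (\<Sum>p\<in>F. \<Sum>q\<in>F. c p * cnj (c q * K (z p) (z q)))"
    unfolding ipg[OF gH] by (intro sum.cong) (auto simp: ipk[OF gH] gz sum_distrib_left)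
  also have "cmod \<dots> \<le> (\<Sum>p\<in>F. \<Sum>q\<in>F. cmod (c p * cnj (c q * K (z p) (z q))))"
    by (intro order.trans[OF norm_sum] sum_mono) auto
  also have "\<dots> = (\<Sum>p\<in>F. \<Sum>q\<in>F. ?A p q * (?y p * ?y q))"
    using mu by (intro sum.cong) (auto simp: c_def norm_mult)
  \<comment> \<open>Weighted arithmetic-geometric mean inequality; the weights are chosen so that each half becomes a row sum of the hypothesis.\<close>
  also have "\<dots> \<le> (\<Sum>p\<in>F. \<Sum>q\<in>F. ?A p q * ((?y p)\<^sup>2 * (v q / v p) / 2 + (?y q)\<^sup>2 * (v p / v q) / 2))"
  proof (intro sum_mono mult_left_mono)
    fix p q assume pq: "p \<in> F" "q \<in> F"
    have "0 \<le> (?y p * v q - ?y q * v p)\<^sup>2" by simp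
    then have "2 * (?y p * ?y q) * (v p * v q) \<le> (?y p)\<^sup>2 * (v q)\<^sup>2 + (?y q)\<^sup>2 * (v p)\<^sup>2"
      by (simp add: power2_diff power_mult_distrib algebra_simps)
    then show "?y p * ?y q \<le> (?y p)\<^sup>2 * (v q / v p) / 2 + (?y q)\<^sup>2 * (v p / v q) / 2"
      using v[OF pq(1)] v[OF pq(2)] by (simp add: field_simps power2_eq_square)
    show "0 \<le> ?A p q" using mu pq by simp
  qed
  also have "\<dots> = (\<Sum>p\<in>F. \<Sum>q\<in>F. ?A p q * ((?y p)\<^sup>2 * (v q / v p)) / 2)
      + (\<Sum>p\<in>F. \<Sum>q\<in>F. ?A p q * ((?y q)\<^sup>2 * (v p / v q)) / 2)"
    by (simp add: sum.distrib algebra_simps)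
  also have "(\<Sum>p\<in>F. \<Sum>q\<in>F. ?A p q * ((?y q)\<^sup>2 * (v p / v q)) / 2)
      = (\<Sum>p\<in>F. \<Sum>q\<in>F. ?A p q * ((?y p)\<^sup>2 * (v q / v p)) / 2)"
    by (subst sum.swap) (intro sum.cong refl, simp add: sym)
  also have "(\<Sum>p\<in>F. \<Sum>q\<in>F. ?A p q * ((?y p)\<^sup>2 * (v q / v p)) / 2) + \<dots>
     = (\<Sum>p\<in>F. \<mu> p * (?y p)\<^sup>2 / v p * (\<Sum>q\<in>F. \<mu> q * cmod (K (z p) (z q)) * v q))"
    by (simp add: sum_distrib_left algebra_simps flip: sum.distrib)
  also have "\<dots> \<le> (\<Sum>p\<in>F. \<mu> p * (?y p)\<^sup>2 / v p * (B * v p))"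
    using mu v row by (intro sum_mono mult_left_mono) (auto simp: less_imp_le)
  also have "\<dots> = (\<Sum>p\<in>F. B * (\<mu> p * (?y p)\<^sup>2))"
  proof (intro sum.cong refl)
    fix p assume "p \<in> F"
    then show "\<mu> p * (?y p)\<^sup>2 / v p * (B * v p) = B * (\<mu> p * (?y p)\<^sup>2)"
      using v[of p] by (simp add: field_simps)
  qed
  also have "\<dots> = B * S"
    by (simp add: S_def sum_distrib_left)
  finally have gg: "Re (ip g g) \<le> B * S"
    unfolding ggs .
  define t where "t = complex_of_real (- 1 / B)"
  define tg where "tg = (\<lambda>x. t * g x)"
  have tg: "tg \<in> H" using scale_mem[OF gH] by (simp add: tg_def)
  have cnjt: "cnj t = t" by (simp add: t_def)
  have e1: "ip tg h = t * ip g h" if "h \<in> H" for h using ip_scale[OF gH that] by (simp add: tg_def)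
  have e2: "ip h tg = t * ip h g" if "h \<in> H" for h
    using ip_cnj[OF tg that] ip_cnj[OF gH that] e1[OF that] cnjt by simp
  define u where "u = (\<lambda>x. f x + tg x)"
  have u: "u \<in> H" using add_mem[OF f tg] by (simp add: u_def)
  have u1: "ip u h = ip f h + ip tg h" if "h \<in> H" for h
    using ip_add[OF f tg that] by (simp add: u_def)
  have u2: "ip h u = ip h f + ip h tg" if "h \<in> H" for h
    using ip_cnj[OF u that] u1[OF that] ip_cnj[OF f that] ip_cnj[OF tg that] by simp
  have "ip u u = ip f f + t * of_real S + t * of_real S + t * t * ip g g"
    by (simp add: u1[OF u] u2[OF f] u2[OF tg] e1[OF f] e1[OF tg] e2[OF f] e2[OF gH] fg gf algebra_simps)
  then have "Re (ip u u) = Re (ip f f) - 2 * S / B + Re (ip g g) / B\<^sup>2"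
    by (simp add: t_def power2_eq_square)
  moreover have "Re (ip u u) \<ge> 0" using ip_norm_sq[OF u] by (metis zero_le_power2)
  moreover have "Re (ip g g) / B\<^sup>2 \<le> S / B"
    using gg B by (simp add: field_simps power2_eq_square)
  ultimately have "S / B \<le> Re (ip f f)" by simp
  then show ?thesis using B by (simp add: S_def ip_norm_sq[OF f] field_simps)
qed

end


section \<open>Carleson sequences as an embedding into a weighted sequence space\<close>

definition kernel_weight :: "complex ^ 'd \<Rightarrow> real"
  where "kernel_weight z = (\<Prod>i\<in>UNIV. 1 - (cmod (z $ i))\<^sup>2)"

lemma kernel_weight_nonneg: "z \<in> polydisc \<Longrightarrow> 0 \<le> kernel_weight z"
  by (auto simp: kernel_weight_def polydisc_def abs_square_le_1 less_imp_le intro!: prod_nonneg)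

lemma open_polydisc: "open (polydisc :: (complex ^ 'd) set)"
proof -
  have "polydisc = (\<Inter>i. {z :: complex ^ 'd. cmod (z $ i) < 1})"
    by (auto simp: polydisc_def)
  also have "open \<dots>"
    by (intro open_INT ballI open_Collect_less continuous_intros) auto
  finally show ?thesis .
qed

context hardy_space
begin

lemma continuous_on_polydisc:
  assumes "f \<in> H" shows "continuous_on polydisc f"
  using analytic[OF assms] unfolding analytic_sv_def
  by (meson continuous_at_imp_continuous_on has_derivative_continuous)

lemma borel_measurable_mem:
  assumes "f \<in> H" shows "f \<in> borel_measurable borel"
proof -
  have "(\<lambda>x. if x \<in> polydisc then f x else 0) \<in> borel_measurable borel"
    using continuous_on_polydisc[OF assms]
    by (intro borel_measurable_continuous_on_if borel_open open_polydisc) auto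
  also have "(\<lambda>x. if x \<in> polydisc then f x else 0) = f"
    using support[OF assms] by auto
  finally show ?thesis .
qed

text \<open>An embedding constant that is a natural number makes the Carleson sequences a countable union,
  and partial sums involve finitely many points at a time: both serve the measurability of the
  Carleson event.\<close>

lemma carleson_sequence_iff:
  assumes z: "\<And>n. z n \<in> polydisc"
  shows "carleson_sequence H ip z \<longleftrightarrow>
    (\<exists>C::nat. \<forall>N. \<forall>f\<in>H. (\<Sum>n<N. kernel_weight (z n) * (cmod (f (z n)))\<^sup>2) \<le> real C * (ip_norm ip f)\<^sup>2)"
proof -
  have *: "(\<integral>\<^sup>+ x. ennreal ((cmod (f x))\<^sup>2) \<partial>seq_measure ip z) \<le> ennreal D \<longleftrightarrow>
     (\<forall>N. (\<Sum>n<N. kernel_weight (z n) * (cmod (f (z n)))\<^sup>2) \<le> D)"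
    if f: "f \<in> H" and D: "D \<ge> 0" for f D
  proof -
    note [measurable] = borel_measurable_mem[OF f]
    have "(\<integral>\<^sup>+ x. ennreal ((cmod (f x))\<^sup>2) \<partial>seq_measure ip z)
      = (\<integral>\<^sup>+ n. ennreal (kernel_weight (z n)) * ennreal ((cmod (f (z n)))\<^sup>2) \<partial>count_space UNIV)"
      unfolding seq_measure_def kernel_norm_sq[OF z]
      by (simp add: nn_integral_distr nn_integral_density kernel_weight_def)
    also have "\<dots> = (\<Sum>n. ennreal (kernel_weight (z n) * (cmod (f (z n)))\<^sup>2))"
      using z by (simp add: nn_integral_count_space_nat ennreal_mult' kernel_weight_nonneg)
    also have "\<dots> = (SUP N. ennreal (\<Sum>n<N. kernel_weight (z n) * (cmod (f (z n)))\<^sup>2))"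
      using z by (simp add: suminf_eq_SUP sum_ennreal kernel_weight_nonneg)
    finally show ?thesis
      using D by (simp add: SUP_le_iff)
  qed
  show ?thesis
  proof
    assume "carleson_sequence H ip z"
    then obtain C where C: "C \<ge> 0"
      "\<And>f. f \<in> H \<Longrightarrow> (\<integral>\<^sup>+ x. ennreal ((cmod (f x))\<^sup>2) \<partial>seq_measure ip z) \<le> ennreal ((C * ip_norm ip f)\<^sup>2)"
      by (auto simp: carleson_sequence_def carleson_measure_def)
    obtain k :: nat where k: "C\<^sup>2 \<le> real k" using real_arch_simple by blast
    have "(\<Sum>n<N. kernel_weight (z n) * (cmod (f (z n)))\<^sup>2) \<le> real k * (ip_norm ip f)\<^sup>2" if "f \<in> H" for N f
    proof -
      have "(\<Sum>n<N. kernel_weight (z n) * (cmod (f (z n)))\<^sup>2) \<le> (C * ip_norm ip f)\<^sup>2"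
        using *[OF that, of "(C * ip_norm ip f)\<^sup>2"] C(2)[OF that] by simp
      also have "\<dots> \<le> real k * (ip_norm ip f)\<^sup>2"
        using k by (simp add: power_mult_distrib mult_right_mono)
      finally show ?thesis .
    qed
    then show "\<exists>C::nat. \<forall>N. \<forall>f\<in>H. (\<Sum>n<N. kernel_weight (z n) * (cmod (f (z n)))\<^sup>2) \<le> real C * (ip_norm ip f)\<^sup>2"
      by blast
  next
    assume "\<exists>C::nat. \<forall>N. \<forall>f\<in>H. (\<Sum>n<N. kernel_weight (z n) * (cmod (f (z n)))\<^sup>2) \<le> real C * (ip_norm ip f)\<^sup>2"
    then obtain C :: nat where C: "\<And>N f. f \<in> H \<Longrightarrow> (\<Sum>n<N. kernel_weight (z n) * (cmod (f (z n)))\<^sup>2) \<le> real C * (ip_norm ip f)\<^sup>2"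
      by blast
    have "(\<integral>\<^sup>+ x. ennreal ((cmod (f x))\<^sup>2) \<partial>seq_measure ip z) \<le> ennreal ((sqrt (real C) * ip_norm ip f)\<^sup>2)" if "f \<in> H" for f
      using *[OF that, of "(sqrt (real C) * ip_norm ip f)\<^sup>2"] C[OF that] by (simp add: power_mult_distrib)
    then show "carleson_sequence H ip z"
      using z unfolding carleson_sequence_def carleson_measure_def
      by (intro conjI allI exI[of _ "sqrt (real C)"]) auto
  qed
qed

end

section \<open>The kernel of the disc at dyadic scales\<close>

lemma one_minus_norm_le_norm_one_minus_cnj_mult:
  fixes z w :: complex
  assumes "cmod w \<le> 1"
  shows "1 - cmod z \<le> cmod (1 - cnj w * z)"
proof -
  have "1 - cmod z \<le> 1 - cmod w * cmod z"
    using assms by (simp add: mult_left_le_one_le)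
  also have "\<dots> \<le> cmod (1 - cnj w * z)"
    using norm_triangle_ineq2[of 1 "cnj w * z"] by (simp add: norm_mult)
  finally show ?thesis .
qed

lemma norm_one_minus_cnj_mult_commute: "cmod (1 - cnj w * z) = cmod (1 - cnj z * w)"
  by (metis complex_cnj_cnj complex_cnj_diff complex_cnj_mult complex_cnj_one complex_mod_cnj mult.commute)

lemma norm_sgn_diff:
  fixes z w :: complex
  assumes "z \<noteq> 0" "w \<noteq> 0"
  shows "cmod (1 - cnj (sgn w) * sgn z) = cmod (sgn z - sgn w)"
proof -
  have "cnj (sgn w) * sgn w = 1"
    using assms complex_norm_square[of "sgn w"] by (simp add: norm_sgn mult.commute)
  then have "1 - cnj (sgn w) * sgn z = cnj (sgn w) * (sgn w - sgn z)"
    by (simp add: algebra_simps)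
  then show ?thesis using assms by (simp add: norm_mult norm_sgn norm_minus_commute)
qed

text \<open>Moving a point of the disc radially to the circle costs at most its distance to the circle,
  which is itself bounded by the distance to be estimated; hence the factor \<open>2\<close>.\<close>

lemma norm_sgn_diff_le_norm_one_minus_cnj_mult:
  fixes z w :: complex
  assumes z: "z \<noteq> 0" "cmod z \<le> 1" and w: "w \<noteq> 0" "cmod w \<le> 1"
  shows "cmod (sgn z - sgn w) \<le> 2 * cmod (1 - cnj w * z)"
proof -
  define \<rho> where "\<rho> = cmod z * cmod w"
  define u where "u = cnj (sgn w) * sgn z"
  have u: "cmod u = 1" using z w by (simp add: u_def norm_mult norm_sgn)
  have rho: "0 \<le> \<rho>" "\<rho> \<le> 1" using z w by (auto simp: \<rho>_def mult_le_one)
  have e: "cnj w * z = of_real \<rho> * u"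
    using z w by (simp add: \<rho>_def u_def sgn_div_norm scaleR_conv_of_real field_simps)
  have "1 - \<rho> \<le> cmod (1 - of_real \<rho> * u)"
    using norm_triangle_ineq2[of 1 "of_real \<rho> * u"] u rho by (simp add: norm_mult)
  moreover have "cmod (1 - u) \<le> cmod (1 - of_real \<rho> * u) + (1 - \<rho>)"
  proof -
    have "1 - u = (1 - of_real \<rho> * u) + (of_real (\<rho> - 1) * u)" by (simp add: algebra_simps)
    then have "cmod (1 - u) \<le> cmod (1 - of_real \<rho> * u) + cmod (of_real (\<rho> - 1) * u)"
      using norm_triangle_ineq by metis
    then show ?thesis using rho u by (simp add: norm_mult del: of_real_diff)
  qed
  ultimately show ?thesis
    using norm_sgn_diff[OF z(1) w(1)] by (simp add: e u_def)
qed

text \<open>The quantity \<open>\<bar>1 - cnj w * z\<bar>\<close> is at least of the order of the largest of \<open>1 - \<bar>z\<bar>\<close>, \<open>1 - \<bar>w\<bar>\<close>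
  and the distance of the arguments. Written as a sum over the scales \<open>k\<close> at which \<open>z\<close> and \<open>w\<close>
  share an arc of length about \<open>1 / 2 ^ k\<close>, the bound turns sums of kernels over a sequence into
  counts of points in boxes.\<close>

lemma inverse_norm_one_minus_le_dyadic_sum:
  fixes z w :: complex
  assumes z: "z \<noteq> 0" "1 / 2 ^ (m + 1) \<le> 1 - cmod z"
    and w: "w \<noteq> 0" "1 / 2 ^ (l + 1) \<le> 1 - cmod w"
  shows "1 / cmod (1 - cnj w * z) \<le> 2 * (\<Sum>k\<le>min l m. 2 ^ k * of_bool (cmod (sgn w - sgn z) \<le> 2 / 2 ^ k))"
proof -
  let ?d = "cmod (sgn w - sgn z)" and ?x = "cmod (1 - cnj w * z)"
  have "(0::real) < 1 / 2 ^ (m + 1)" "(0::real) < 1 / 2 ^ (l + 1)" by auto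
  then have z1: "cmod z < 1" and w1: "cmod w < 1" using z w by linarith+
  have x1: "1 / 2 ^ (m + 1) \<le> ?x"
    using one_minus_norm_le_norm_one_minus_cnj_mult[of w z] z w1 by simp
  have x2: "1 / 2 ^ (l + 1) \<le> ?x"
    using one_minus_norm_le_norm_one_minus_cnj_mult[of z w] w z1
    by (simp add: norm_one_minus_cnj_mult_commute[of w z])
  have x3: "?d \<le> 2 * ?x"
    using norm_sgn_diff_le_norm_one_minus_cnj_mult[of z w] z w z1 w1 by (simp add: norm_minus_commute)
  define S where "S = {k. k \<le> min l m \<and> ?d \<le> 2 / 2 ^ k}"
  have "?d \<le> cmod (sgn w) + cmod (sgn z)" by (rule norm_triangle_ineq4)
  also have "\<dots> = 2" using z w by (simp add: norm_sgn)
  finally have "0 \<in> S" by (simp add: S_def)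
  moreover have fin: "finite S" by (auto simp: S_def)
  ultimately have k: "Max S \<in> S" by (intro Max_in) auto
  define k where "k = Max S"
  have kS: "k \<le> min l m" "?d \<le> 2 / 2 ^ k" using k by (auto simp: S_def k_def)
  have "1 / 2 ^ (k + 1) \<le> ?x"
  proof (cases "k = min l m")
    case True
    then show ?thesis using x1 x2 by (auto simp: min_def split: if_splits)
  next
    case False
    have "Suc k \<notin> S" using Max_ge[OF fin, of "Suc k"] by (auto simp: k_def)
    then have "?d > 2 / 2 ^ Suc k" using False kS by (auto simp: S_def)
    then have "1 / 2 ^ k < 2 * ?x" using x3 by simp
    then show ?thesis by (simp add: field_simps)
  qed
  moreover have "0 < ?x" by (rule less_le_trans[OF _ x1]) simp
  ultimately have "1 / ?x \<le> 2 * 2 ^ k" by (simp add: field_simps)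
  also have "\<dots> = 2 * (2 ^ k * of_bool (?d \<le> 2 / 2 ^ k))" using kS by simp
  also have "\<dots> \<le> 2 * (\<Sum>k\<le>min l m. 2 ^ k * of_bool (?d \<le> 2 / 2 ^ k))"
    using kS(1) by (intro mult_left_mono member_le_sum) auto
  finally show ?thesis .
qed

lemma one_minus_norm_sq_le: "1 - (cmod w)\<^sup>2 \<le> 2 * (1 - cmod w)"
proof -
  have "0 \<le> (1 - cmod w)\<^sup>2" by simp
  then show ?thesis by (simp add: power2_diff)
qed

section \<open>Sparse sequences are Carleson sequences\<close>

lemma sum_power_le: 
  fixes a :: real
  assumes "0 \<le> a" "a < 1" "finite S"
  shows "(\<Sum>n\<in>S. a ^ n) \<le> 1 / (1 - a)"
  using sum_le_suminf[OF summable_geometric assms(3), of a] suminf_geometric[of a] assms by simp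

text \<open>With \<open>b = 1 / (2 * a)\<close> the sum over \<open>k\<close> is of order \<open>a ^ (m - l)\<close> for \<open>l \<le> m\<close> and of order
  \<open>b ^ (l - m)\<close> for \<open>l \<ge> m\<close>: since both \<open>a\<close> and \<open>b\<close> are below \<open>1\<close>, the levels interact with
  geometric decay in both directions. Without the weights \<open>a ^ m\<close> and \<open>(1 / a) ^ l\<close>, each level
  \<open>l \<le> m\<close> would contribute an amount of order one.\<close>

lemma sum_geometric_interaction_le:
  fixes a :: real
  assumes a: "1/2 < a" "a < 1"
  shows "(\<Sum>(l,k)\<in>(SIGMA l:{..R}. {..min l m}). 2 ^ k * (1 / (2 * a)) ^ l * a ^ m)
    \<le> 1 / ((1 - a) * (1 - 1 / (2 * a)))"
proof -
  define b where "b = 1 / (2 * a)"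
  have b: "0 < b" "b < 1" using a by (auto simp: b_def)
  have tb: "2 * b = 1 / a" using a by (simp add: b_def)
  have "(\<Sum>(l,k)\<in>(SIGMA l:{..R}. {..min l m}). 2 ^ k * b ^ l * a ^ m) = (\<Sum>(k,l)\<in>(SIGMA k:{..m}. {k..R}). 2 ^ k * b ^ l * a ^ m)"
    by (rule sum.reindex_bij_witness[of _ "\<lambda>(k,l). (l,k)" "\<lambda>(l,k). (k,l)"]) auto
  also have "\<dots> = (\<Sum>k\<le>m. 2 ^ k * a ^ m * (\<Sum>l\<in>{k..R}. b ^ l))"
    by (subst sum.Sigma[symmetric]) (auto simp: sum_distrib_left algebra_simps)
  also have "\<dots> \<le> (\<Sum>k\<le>m. 2 ^ k * a ^ m * (b ^ k * (1 / (1 - b))))"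
  proof (intro sum_mono mult_left_mono)
    fix k
    have "(\<Sum>l\<in>{k..R}. b ^ l) = (\<Sum>l\<in>{k..R}. b ^ k * b ^ (l - k))"
      by (intro sum.cong) (auto simp flip: power_add)
    also have "\<dots> = b ^ k * (\<Sum>j\<in>(\<lambda>l. l - k) ` {k..R}. b ^ j)"
      by (subst sum.reindex) (auto simp: sum_distrib_left inj_on_def)
    also have "\<dots> \<le> b ^ k * (1 / (1 - b))"
      using b by (intro mult_left_mono sum_power_le) auto
    finally show "(\<Sum>l\<in>{k..R}. b ^ l) \<le> b ^ k * (1 / (1 - b))" .
  qed (use a in auto)
  also have "\<dots> = (\<Sum>k\<le>m. a ^ (m - k)) * (1 / (1 - b))"
  proof -
    have "2 ^ k * a ^ m * (b ^ k * (1 / (1 - b))) = a ^ (m - k) * (1 / (1 - b))" if "k \<le> m" for k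
    proof -
      have "2 ^ k * a ^ m * b ^ k = (2 * b) ^ k * a ^ m" by (simp add: power_mult_distrib)
      also have "\<dots> = a ^ (m - k)" using that a by (simp add: tb power_divide power_diff)
      finally show ?thesis by (metis mult.assoc)
    qed
    then show ?thesis unfolding sum_distrib_right by (intro sum.cong) auto
  qed
  also have "(\<Sum>k\<le>m. a ^ (m - k)) = (\<Sum>j\<le>m. a ^ j)"
    by (rule sum.reindex_bij_witness[of _ "\<lambda>j. m - j" "\<lambda>j. m - j"]) auto
  also have "\<dots> * (1 / (1 - b)) \<le> 1 / (1 - a) * (1 / (1 - b))"
    using a b by (intro mult_right_mono sum_power_le) auto
  finally show ?thesis by (simp add: b_def)
qed

lemma sum_geometric_mean_le:
  fixes a :: real
  assumes a: "0 < a" "a < 1"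
  shows "(\<Sum>(l,k)\<in>(SIGMA l:{..R}. {..min l m}). a ^ l * a ^ m) \<le> 1 / (1 - a)\<^sup>2"
proof -
  have "(\<Sum>(l,k)\<in>(SIGMA l:{..R}. {..min l m}). a ^ l * a ^ m)
      = (\<Sum>l\<le>R. real (Suc (min l m)) * (a ^ l * a ^ m))"
    by (subst sum.Sigma[symmetric]) auto
  also have "\<dots> \<le> (\<Sum>l\<le>R. real (Suc l) * (a ^ l * 1))"
    using a by (intro sum_mono mult_mono) (auto simp: power_le_one)
  also have "\<dots> = (\<Sum>l\<le>R. of_nat (Suc l) * a ^ l)" by simp
  also have "\<dots> \<le> 1 / (1 - a)\<^sup>2"
  proof -
    have "(\<lambda>n. of_nat (Suc n) * a ^ n) sums (1 / (1 - a)\<^sup>2)"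
      using geometric_deriv_sums[of a] a by simp
    then show ?thesis using a
      by (subst sums_unique) (auto intro!: sum_le_suminf simp: sums_iff)
  qed
  finally show ?thesis .
qed

context hardy_space
begin

text \<open>In a box with sides of the order \<open>1 / 2 ^ k i\<close>, the points of level \<open>l\<close> may number \<open>K\<close> times the
  share of this box in \<open>(2 * a\<^sup>2) ^ \<Sum>l\<close> points distributed evenly over the torus, and \<open>K\<close> more.
  The Schur vector is
  \<open>v n = (1 / a) ^ \<Sum>(lev n)\<close>; the exponent \<open>2\<close> in \<open>a\<^sup>2\<close> leaves one factor \<open>a ^ l\<close> to spare
  after one has been spent on \<open>v\<close>. Dominating the kernel by the dyadic sums in every coordinate
  and expanding the product over the coordinates bounds a row sum by a sum over pairs of
  multi-indices \<open>(l, k)\<close> of products of weights times counts; after the bound on the counts this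
  sum is again a product over the coordinates.\<close>

theorem carleson_sequence_if_sparse:
  fixes z :: "nat \<Rightarrow> complex ^ 'd" and lev :: "nat \<Rightarrow> 'd \<Rightarrow> nat" and a K :: real
  assumes a: "1/2 < a" "a < 1" and K: "K > 0"
    and nz: "\<And>n i. z n $ i \<noteq> 0"
    and lev: "\<And>n i. 1 / 2 ^ (lev n i + 1) \<le> 1 - cmod (z n $ i) \<and> 1 - cmod (z n $ i) \<le> 1 / 2 ^ lev n i"
    and fin: "\<And>l. finite {q. lev q = l}"
    and count: "\<And>p l k. (\<And>i. k i \<le> l i) \<Longrightarrow>
      real (card {q. lev q = l \<and> (\<forall>i. cmod (sgn (z q $ i) - sgn (z p $ i)) \<le> 2 / 2 ^ k i)})
        \<le> K * (1 + (\<Prod>i\<in>UNIV. (2 * a\<^sup>2) ^ l i / 2 ^ k i))"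
  shows "carleson_sequence H ip z"
proof -
  have lt1: "cmod (z n $ i) < 1" for n i
  proof -
    have "(0::real) < 1 / 2 ^ (lev n i + 1)" by auto
    then show ?thesis using lev[of n i] by linarith
  qed
  have zp: "z n \<in> polydisc" for n using lt1 by (auto simp: polydisc_def)
  define s1 where "s1 = 1 / ((1 - a) * (1 - 1 / (2 * a)))"
  define s2 where "s2 = 1 / (1 - a)\<^sup>2"
  have s: "s1 > 0" "s2 > 0" using a by (auto simp: s1_def s2_def)
  define B where "B = K * ((\<Prod>i\<in>(UNIV::'d set). 4 * s1) + (\<Prod>i\<in>(UNIV::'d set). 4 * s2))"
  have B: "B > 0" unfolding B_def using K s by (intro mult_pos_pos add_pos_pos prod_pos) auto
  define v where "v n = (\<Prod>i\<in>UNIV. 1 / a ^ lev n i)" for n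
  have v: "v n > 0" for n using a by (auto simp: v_def intro!: prod_pos)
  have row: "(\<Sum>q<N. kernel_weight (z q) * cmod (szego (z p) (z q)) * v q) \<le> B * v p" for p N
  proof -
    define R where "R = Max ((\<lambda>(q,i). lev q i) ` ({..<N} \<times> (UNIV :: 'd set)))"
    have R: "lev q i \<le> R" if "q < N" for q i
      unfolding R_def using that by (intro Max_ge) auto
    define D where "D i = (SIGMA l:{..R}. {..min l (lev p i)})" for i
    have finD: "finite (D i)" for i by (simp add: D_def)
    define c where "c i x = (case x of (l, k) \<Rightarrow> 4 * (2 ^ k * (1 / (2 * a)) ^ l * a ^ lev p i))" for i and x :: "nat \<times> nat"
    have c0: "c i x \<ge> 0" for i x using a by (auto simp: c_def split: prod.splits)
    define near where "near q i x \<longleftrightarrow> lev q i = fst x \<and> cmod (sgn (z q $ i) - sgn (z p $ i)) \<le> 2 / 2 ^ snd x" for q i and x :: "nat \<times> nat"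
    \<comment> \<open>The factor of coordinate \<open>i\<close> in the entry of the Schur matrix at \<open>(p, q)\<close>, including \<open>v q / v p\<close>.\<close>
    define t where "t q i = (1 - (cmod (z q $ i))\<^sup>2) * (1 / cmod (1 - cnj (z q $ i) * z p $ i)) * (a ^ lev p i / a ^ lev q i)" for q i
    have t: "0 \<le> t q i \<and> t q i \<le> (\<Sum>x\<in>D i. c i x * of_bool (near q i x))" if q: "q < N" for q i
    proof
      let ?l = "lev q i" and ?m = "lev p i"
      let ?P = "\<lambda>k. cmod (sgn (z q $ i) - sgn (z p $ i)) \<le> 2 / 2 ^ k"
      have sq: "0 \<le> 1 - (cmod (z q $ i))\<^sup>2"
        using lt1[of q i] by (simp add: abs_square_le_1)
      then show "0 \<le> t q i" using a by (simp add: t_def)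
      have "t q i \<le> (2 * (1 / 2 ^ ?l)) * (2 * (\<Sum>k\<le>min ?l ?m. 2 ^ k * of_bool (?P k))) * (a ^ ?m / a ^ ?l)"
        unfolding t_def
      proof (intro mult_mono)
        show "1 - (cmod (z q $ i))\<^sup>2 \<le> 2 * (1 / 2 ^ ?l)"
          by (rule order_trans[OF one_minus_norm_sq_le mult_left_mono[OF lev[of q i, THEN conjunct2]]]) simp
        show "1 / cmod (1 - cnj (z q $ i) * z p $ i) \<le> 2 * (\<Sum>k\<le>min ?l ?m. 2 ^ k * of_bool (?P k))"
          using lev nz by (intro inverse_norm_one_minus_le_dyadic_sum) auto
      qed (use a sq in \<open>auto intro!: sum_nonneg divide_nonneg_nonneg mult_nonneg_nonneg\<close>)
      also have "\<dots> = (\<Sum>k\<le>min ?l ?m. c i (?l, k) * of_bool (?P k))"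
      proof -
        have "c i (?l, k) = (2 * (1 / 2 ^ ?l)) * (2 * 2 ^ k) * (a ^ ?m / a ^ ?l)" for k
          by (simp add: c_def power_mult_distrib power_divide)
        then show ?thesis
          unfolding sum_distrib_left sum_distrib_right by (intro sum.cong refl) simp
      qed
      also have "\<dots> = (\<Sum>x\<in>(\<lambda>k. (?l, k)) ` {..min ?l ?m}. c i x * of_bool (near q i x))"
        by (subst sum.reindex) (auto simp: inj_on_def near_def)
      also have "\<dots> \<le> (\<Sum>x\<in>D i. c i x * of_bool (near q i x))"
        using R[OF q] finD c0 by (intro sum_mono2) (auto simp: D_def)
      finally show "t q i \<le> (\<Sum>x\<in>D i. c i x * of_bool (near q i x))" .
    qed
    have tq: "kernel_weight (z q) * cmod (szego (z p) (z q)) * v q = v p * (\<Prod>i\<in>UNIV. t q i)" for q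
    proof -
      have "kernel_weight (z q) * cmod (szego (z p) (z q)) * v q
        = (\<Prod>i\<in>UNIV. (1 - (cmod (z q $ i))\<^sup>2) * (1 / cmod (1 - cnj (z q $ i) * z p $ i)) * (1 / a ^ lev q i))"
        unfolding kernel_weight_def szego_def v_def prod.distrib prod_norm[symmetric]
        by (simp add: norm_divide)
      also have "\<dots> = (\<Prod>i\<in>UNIV. (1 / a ^ lev p i) * t q i)"
        using a by (intro prod.cong) (auto simp: t_def)
      also have "\<dots> = v p * (\<Prod>i\<in>UNIV. t q i)"
        unfolding prod.distrib v_def ..
      finally show ?thesis .
    qed
    have prod_of_bool: "(\<Prod>i\<in>UNIV. of_bool (P i)) = (of_bool (\<forall>i. P i) :: real)" for P :: "'d \<Rightarrow> bool"
      by auto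
    have cardle: "real (card {q. q < N \<and> (\<forall>i. near q i (g i))}) \<le> K * (1 + (\<Prod>i\<in>UNIV. (2 * a\<^sup>2) ^ fst (g i) / 2 ^ snd (g i)))"
      if g: "g \<in> Pi\<^sub>E UNIV D" for g
    proof -
      let ?S = "{q. lev q = (\<lambda>i. fst (g i)) \<and> (\<forall>i. cmod (sgn (z q $ i) - sgn (z p $ i)) \<le> 2 / 2 ^ (snd (g i)))}"
      have "card {q. q < N \<and> (\<forall>i. near q i (g i))} \<le> card ?S"
        using finite_subset[OF _ fin[of "\<lambda>i. fst (g i)"], of ?S] by (intro card_mono) (auto simp: near_def)
      also have "real (card ?S) \<le> K * (1 + (\<Prod>i\<in>UNIV. (2 * a\<^sup>2) ^ fst (g i) / 2 ^ snd (g i)))"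
      proof (rule count)
        fix i
        have "g i \<in> D i" using g by auto
        then show "snd (g i) \<le> fst (g i)" by (auto simp: D_def)
      qed
      finally show ?thesis by simp
    qed
    have "(\<Sum>q<N. \<Prod>i\<in>UNIV. t q i) \<le> (\<Sum>q<N. \<Prod>i\<in>UNIV. \<Sum>x\<in>D i. c i x * of_bool (near q i x))"
      using t by (intro sum_mono prod_mono) auto
    also have "\<dots> = (\<Sum>q<N. \<Sum>g\<in>Pi\<^sub>E UNIV D. (\<Prod>i\<in>UNIV. c i (g i)) * of_bool (\<forall>i. near q i (g i)))"
      by (simp only: prod_sum_PiE[OF finite finD] prod.distrib prod_of_bool)
    also have "\<dots> = (\<Sum>g\<in>Pi\<^sub>E UNIV D. (\<Prod>i\<in>UNIV. c i (g i)) * real (card {q. q < N \<and> (\<forall>i. near q i (g i))}))"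
      by (subst sum.swap) (simp add: sum_distrib_left[symmetric] of_bool_def sum.If_cases Int_def)
    also have "\<dots> \<le> (\<Sum>g\<in>Pi\<^sub>E UNIV D. (\<Prod>i\<in>UNIV. c i (g i)) * (K * (1 + (\<Prod>i\<in>UNIV. (2 * a\<^sup>2) ^ fst (g i) / 2 ^ snd (g i)))))"
      using cardle c0 by (intro sum_mono mult_left_mono prod_nonneg) auto
    also have "\<dots> = K * ((\<Sum>g\<in>Pi\<^sub>E UNIV D. \<Prod>i\<in>UNIV. c i (g i))
         + (\<Sum>g\<in>Pi\<^sub>E UNIV D. \<Prod>i\<in>UNIV. c i (g i) * ((2 * a\<^sup>2) ^ fst (g i) / 2 ^ snd (g i))))"
    proof -
      have "x * (K * (1 + y)) = K * (x + x * y)" for x y by (simp add: algebra_simps)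
      then show ?thesis
        by (simp only: prod.distrib sum.distrib[symmetric] sum_distrib_left)
    qed
    also have "\<dots> = K * ((\<Prod>i\<in>UNIV. \<Sum>x\<in>D i. c i x)
         + (\<Prod>i\<in>UNIV. \<Sum>x\<in>D i. c i x * ((2 * a\<^sup>2) ^ fst x / 2 ^ snd x)))"
      by (simp only: prod_sum_PiE[OF finite finD])
    also have "\<dots> \<le> B"
      unfolding B_def
    proof (intro mult_left_mono add_mono prod_mono conjI)
      fix i :: 'd
      have "(\<Sum>x\<in>D i. c i x) = 4 * (\<Sum>(l,k)\<in>D i. 2 ^ k * (1 / (2 * a)) ^ l * a ^ lev p i)"
        by (simp add: c_def sum_distrib_left case_prod_unfold)
      also have "\<dots> \<le> 4 * s1"
        unfolding D_def s1_def by (intro mult_left_mono sum_geometric_interaction_le a) simp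
      finally show "(\<Sum>x\<in>D i. c i x) \<le> 4 * s1" .
      have "c i x * ((2 * a\<^sup>2) ^ fst x / 2 ^ snd x) = 4 * (a ^ fst x * a ^ lev p i)" for x
        using a by (simp add: c_def case_prod_unfold power_divide power_mult_distrib power2_eq_square)
      then have "(\<Sum>x\<in>D i. c i x * ((2 * a\<^sup>2) ^ fst x / 2 ^ snd x)) = 4 * (\<Sum>(l,k)\<in>D i. a ^ l * a ^ lev p i)"
        by (simp add: sum_distrib_left case_prod_unfold)
      also have "\<dots> \<le> 4 * s2"
        unfolding D_def s2_def using a by (intro mult_left_mono sum_geometric_mean_le) auto
      finally show "(\<Sum>x\<in>D i. c i x * ((2 * a\<^sup>2) ^ fst x / 2 ^ snd x)) \<le> 4 * s2" .
    qed (use K c0 a in \<open>auto intro!: sum_nonneg mult_nonneg_nonneg\<close>)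
    finally have "v p * (\<Sum>q<N. \<Prod>i\<in>UNIV. t q i) \<le> v p * B"
      using v[of p] by (intro mult_left_mono) auto
    then show ?thesis by (simp only: tq sum_distrib_left[symmetric] mult.commute[of B])
  qed
  obtain C :: nat where C: "B \<le> real C" using real_arch_simple by blast
  have "(\<Sum>n<N. kernel_weight (z n) * (cmod (f (z n)))\<^sup>2) \<le> real C * (ip_norm ip f)\<^sup>2" if "f \<in> H" for N f
  proof -
    have "(\<Sum>n<N. kernel_weight (z n) * (cmod (f (z n)))\<^sup>2) \<le> B * (ip_norm ip f)\<^sup>2"
      using schur_test[where F = "{..<N}" and z = z and \<mu> = "\<lambda>n. kernel_weight (z n)" and v = v and B = B]
        zp kernel_weight_nonneg[OF zp] v B row that by simp
    also have "\<dots> \<le> real C * (ip_norm ip f)\<^sup>2" using C by (intro mult_right_mono) auto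
    finally show ?thesis .
  qed
  then show ?thesis using carleson_sequence_iff[of z] zp by blast
qed

end

section \<open>Uniform random points of the torus\<close>

definition circle_exp :: "real \<Rightarrow> complex"
  where "circle_exp t = exp (2 * complex_of_real pi * \<i> * complex_of_real t)"

lemma norm_circle_exp [simp]: "cmod (circle_exp t) = 1"
  by (simp add: circle_exp_def)

lemma circle_exp_diff: "circle_exp t - circle_exp s = circle_exp s * (circle_exp (t - s) - 1)"
  by (simp add: circle_exp_def algebra_simps flip: exp_add)

lemma norm_circle_exp_diff: "cmod (circle_exp t - circle_exp s) = 2 * \<bar>sin (pi * (t - s))\<bar>"
proof -
  have "circle_exp (t - s) = exp (\<i> * complex_of_real (2 * pi * (t - s)))"
    by (simp add: circle_exp_def mult_ac)
  then show ?thesis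
    using dist_exp_i_1[of "2 * pi * (t - s)"] circle_exp_diff[of t s] by (simp add: norm_mult)
qed

lemma norm_circle_exp_diff_le: "cmod (circle_exp t - circle_exp s) \<le> 7 * \<bar>t - s\<bar>"
proof -
  have "\<bar>sin (pi * (t - s))\<bar> \<le> \<bar>pi * (t - s)\<bar>" by (rule abs_sin_x_le_abs_x)
  also have "\<dots> = pi * \<bar>t - s\<bar>" by (simp add: abs_mult)
  also have "\<dots> \<le> (7/2) * \<bar>t - s\<bar>"
    using pi_less_4 pi_approx by (intro mult_right_mono) auto
  finally show ?thesis by (simp add: norm_circle_exp_diff)
qed

lemma circle_exp_frac: "circle_exp (frac t) = circle_exp t"
proof -
  have "circle_exp t = circle_exp (frac t) * exp (2 * of_int \<lfloor>t\<rfloor> * complex_of_real pi * \<i>)"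
    by (simp add: circle_exp_def frac_def algebra_simps flip: exp_add)
  also have "exp (2 * of_int \<lfloor>t\<rfloor> * complex_of_real pi * \<i>) = 1"
    using exp_integer_2pi[of "of_int \<lfloor>t\<rfloor>"] by simp
  finally show ?thesis by simp
qed

lemma abs_sin_ge_half:
  fixes x :: real
  assumes "\<bar>x\<bar> \<le> pi / 2"
  shows "\<bar>x\<bar> / 2 \<le> \<bar>sin x\<bar>"
proof -
  have "\<bar>sin x - (\<Sum>m<3. sin_coeff m * x ^ m)\<bar> \<le> inverse (fact 3) * \<bar>x\<bar> ^ 3"
    by (rule Maclaurin_sin_bound)
  then have "\<bar>sin x - x\<bar> \<le> \<bar>x\<bar> ^ 3 / 6"
    by (simp add: eval_nat_numeral sin_coeff_def)
  also have "\<bar>x\<bar> ^ 3 = \<bar>x\<bar> ^ 2 * \<bar>x\<bar>" by (simp add: eval_nat_numeral)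
  also have "\<dots> \<le> 3 * \<bar>x\<bar>"
  proof (intro mult_right_mono)
    have "\<bar>x\<bar> \<le> 17/10" using assms pi_approx by simp
    then have "\<bar>x\<bar> ^ 2 \<le> (17/10) ^ 2" by (intro power_mono) auto
    then show "\<bar>x\<bar> ^ 2 \<le> 3" by (simp add: power2_eq_square)
  qed auto
  finally show ?thesis by linarith
qed

text \<open>Modulo the period, \<open>t - s\<close> lies within \<open>\<rho> / 2\<close> of \<open>0\<close>, and since \<open>s\<close> and \<open>t\<close> are in the unit
  interval only the translates by \<open>-1\<close>, \<open>0\<close> and \<open>1\<close> matter.\<close>

lemma emeasure_arc_le:
  assumes s: "0 \<le> s" "s \<le> 1" and rho: "\<rho> \<ge> 0"
  shows "emeasure lborel ({t. cmod (circle_exp t - circle_exp s) \<le> \<rho>} \<inter> {0..<1}) \<le> ennreal (3 * \<rho>)"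
proof -
  let ?I = "\<lambda>j. {s + j - \<rho> / 2 .. s + j + \<rho> / 2}"
  have "{t. cmod (circle_exp t - circle_exp s) \<le> \<rho>} \<inter> {0..<1} \<subseteq> ?I (-1) \<union> ?I 0 \<union> ?I 1"
  proof
    fix t assume t: "t \<in> {t. cmod (circle_exp t - circle_exp s) \<le> \<rho>} \<inter> {0..<1}"
    obtain j :: real where j: "j \<in> {-1,0,1}" "\<bar>t - s - j\<bar> \<le> 1/2"
    proof -
      have "\<bar>t - s + 1\<bar> \<le> 1/2 \<or> \<bar>t - s\<bar> \<le> 1/2 \<or> \<bar>t - s - 1\<bar> \<le> 1/2"
      proof -
        have "-1 \<le> t - s" "t - s \<le> 1" using t s by auto
        then show ?thesis by arith
      qed
      then show ?thesis using that[of "-1"] that[of 0] that[of 1] by auto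
    qed
    have "circle_exp (t - s - j) = circle_exp (t - s)"
    proof -
      have "frac (t - s - j) = frac (t - s)" using j(1) by (auto simp: frac_def)
      then show ?thesis by (metis circle_exp_frac)
    qed
    then have "cmod (circle_exp t - circle_exp s) = cmod (circle_exp (t - s - j) - 1)"
      by (simp add: circle_exp_diff[of t s] norm_mult)
    also have "\<dots> = 2 * \<bar>sin (pi * (t - s - j))\<bar>"
      using norm_circle_exp_diff[of "t - s - j" 0] by (simp add: circle_exp_def)
    also have "\<dots> \<ge> 2 * (\<bar>pi * (t - s - j)\<bar> / 2)"
      using j(2) by (intro mult_left_mono abs_sin_ge_half) (auto simp: abs_mult)
    also have "2 * (\<bar>pi * (t - s - j)\<bar> / 2) \<ge> 2 * \<bar>t - s - j\<bar>"
      using pi_ge_two by (simp add: abs_mult mult_right_mono)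
    finally have "2 * \<bar>t - s - j\<bar> \<le> \<rho>" using t by simp
    then have "\<bar>t - s - j\<bar> \<le> \<rho> / 2" by simp
    then have "t \<in> ?I j" using abs_le_D1 abs_le_D2 by fastforce
    then show "t \<in> ?I (-1) \<union> ?I 0 \<union> ?I 1" using j(1) by auto
  qed
  then have "emeasure lborel ({t. cmod (circle_exp t - circle_exp s) \<le> \<rho>} \<inter> {0..<1})
      \<le> emeasure lborel (?I (-1) \<union> ?I 0 \<union> ?I 1)" by (intro emeasure_mono) auto
  also have "\<dots> \<le> emeasure lborel (?I (-1) \<union> ?I 0) + emeasure lborel (?I 1)"
    by (intro emeasure_subadditive) auto
  also have "\<dots> \<le> emeasure lborel (?I (-1)) + emeasure lborel (?I 0) + emeasure lborel (?I 1)"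
    by (intro add_right_mono emeasure_subadditive) auto
  also have "\<dots> = ennreal (3 * \<rho>)"
    using rho by (simp add: emeasure_lborel_Icc_eq flip: ennreal_plus)
  finally show ?thesis .
qed

lemma emeasure_lborel_product_set:
  fixes S :: "'d::finite \<Rightarrow> real set"
  assumes S: "\<And>i. S i \<in> sets borel"
  shows "emeasure lborel {x :: real ^ 'd. \<forall>i. x $ i \<in> S i} = (\<Prod>i\<in>UNIV. emeasure lborel (S i))"
    and "{x :: real ^ 'd. \<forall>i. x $ i \<in> S i} \<in> sets borel"
proof -
  define idx :: "real ^ 'd \<Rightarrow> 'd" where "idx = inv (\<lambda>i. axis i 1)"
  have inj: "inj (\<lambda>i::'d. axis i (1::real))" by (auto simp: inj_on_def axis_eq_axis)
  have idx: "idx (axis i 1) = i" for i unfolding idx_def using inj by (rule inv_f_f)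
  have Bas: "(Basis :: (real ^ 'd) set) = (\<lambda>i. axis i 1) ` UNIV" by (auto simp: Basis_vec_def)
  show meas: "{x :: real ^ 'd. \<forall>i. x $ i \<in> S i} \<in> sets borel"
  proof -
    have "{x :: real ^ 'd. \<forall>i. x $ i \<in> S i} = (\<Inter>i. (\<lambda>x. x $ i) -` S i \<inter> space borel)" by auto
    also have "\<dots> \<in> sets borel"
      by (intro sets.finite_INT measurable_sets[OF _ S]) (auto intro!: borel_measurable_continuous_onI continuous_intros)
    finally show ?thesis .
  qed
  have "emeasure lborel {x :: real ^ 'd. \<forall>i. x $ i \<in> S i}
    = (\<integral>\<^sup>+x. (\<Prod>b\<in>Basis. indicator (S (idx b)) (x \<bullet> b)) \<partial>lborel)"
  proof (subst nn_integral_indicator[symmetric])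
    have "indicator {x. \<forall>i. x $ i \<in> S i} x = (\<Prod>b\<in>Basis. indicator (S (idx b)) (x \<bullet> b) :: ennreal)" for x
      using inj by (auto simp: Bas prod.reindex idx inner_axis indicator_def)
    then show "(\<integral>\<^sup>+x. indicator {x :: real ^ 'd. \<forall>i. x $ i \<in> S i} x \<partial>lborel) =
      (\<integral>\<^sup>+x. (\<Prod>b\<in>Basis. indicator (S (idx b)) (x \<bullet> b)) \<partial>lborel)" by simp
  qed (use meas in auto)
  also have "\<dots> = (\<Prod>b\<in>(Basis::(real^'d) set). (\<integral>\<^sup>+x. indicator (S (idx b)) x \<partial>lborel))"
    using S by (intro nn_integral_lborel_prod) auto
  also have "\<dots> = (\<Prod>i\<in>UNIV. emeasure lborel (S i))"
    using S inj by (simp add: Bas prod.reindex idx)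
  finally show "emeasure lborel {x :: real ^ 'd. \<forall>i. x $ i \<in> S i} = (\<Prod>i\<in>UNIV. emeasure lborel (S i))" .
qed

lemma emeasure_uniform_cube:
  fixes X :: "'w \<Rightarrow> real ^ 'd" and S :: "'d \<Rightarrow> real set"
  assumes X: "X \<in> borel_measurable M" and dist: "distr M borel X = uniform_measure lborel unit_cube"
    and S: "\<And>i. S i \<in> sets borel"
  shows "emeasure M (X -` {x. \<forall>i. x $ i \<in> S i} \<inter> space M) = (\<Prod>i\<in>UNIV. emeasure lborel (S i \<inter> {0..<1}))"
proof -
  let ?A = "{x :: real ^ 'd. \<forall>i. x $ i \<in> S i}"
  have cube: "(unit_cube :: (real^'d) set) = {x. \<forall>i. x $ i \<in> {0..<1}}" by (auto simp: unit_cube_def)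
  have cube1: "emeasure lborel (unit_cube :: (real^'d) set) = 1"
    by (subst cube, subst emeasure_lborel_product_set) auto
  have "emeasure M (X -` ?A \<inter> space M) = emeasure (distr M borel X) ?A"
    using emeasure_lborel_product_set(2)[of S, OF S] by (intro emeasure_distr[symmetric] X) auto
  also have "\<dots> = emeasure lborel (unit_cube \<inter> ?A) / emeasure lborel (unit_cube :: (real^'d) set)"
    unfolding dist using emeasure_lborel_product_set(2)[OF S] emeasure_lborel_product_set(2)[of "\<lambda>_. {0..<1}"]
    by (intro emeasure_uniform_measure) (auto simp: cube)
  also have "unit_cube \<inter> ?A = {x. \<forall>i. x $ i \<in> S i \<inter> {0..<1}}" by (auto simp: cube)
  also have "emeasure lborel \<dots> = (\<Prod>i\<in>UNIV. emeasure lborel (S i \<inter> {0..<1}))"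
    using S by (intro emeasure_lborel_product_set) auto
  finally show ?thesis by (simp add: cube1 divide_ennreal_def)
qed

section \<open>Random points do not cluster\<close>

text \<open>The triples \<open>(l, k, c)\<close> are the levels \<open>l\<close> of the points in one coordinate, together with the
  arcs of length \<open>1 / 2 ^ k\<close>, numbered by \<open>c\<close>, in which such points are counted. Any weight that
  beats the \<open>2 ^ l\<close> arcs geometrically would do in place of \<open>(1 / 8) ^ l\<close>.\<close>

lemma sum_cell_weights_le:
  "(\<Sum>(l,k,c)\<in>(SIGMA l:{..R}. SIGMA k:{..l}. {..<2 ^ k :: nat}). (1 / 8) ^ l) \<le> (2 :: real)"
proof -
  have "(\<Sum>(l,k,c)\<in>(SIGMA l:{..R}. SIGMA k:{..l}. {..<2 ^ k :: nat}). (1 / 8 :: real) ^ l)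
    = (\<Sum>l\<le>R. \<Sum>k\<le>l. 2 ^ k * (1 / 8 :: real) ^ l)"
    by (subst sum.Sigma[symmetric], simp, simp)+ (simp add: sum.Sigma[symmetric] case_prod_unfold)
  also have "\<dots> \<le> (\<Sum>l\<le>R. \<Sum>k\<le>l. 2 ^ l * (1 / 8 :: real) ^ l)"
    by (intro sum_mono mult_right_mono power_increasing) auto
  also have "\<dots> = (\<Sum>l\<le>R. of_nat (Suc l) * (1 / 4 :: real) ^ l)"
    by (simp add: algebra_simps flip: power_mult_distrib)
  also have "\<dots> \<le> 1 / (1 - 1 / 4)\<^sup>2"
    using geometric_deriv_sums[of "1/4 :: real"]
    by (subst sums_unique) (auto intro!: sum_le_suminf simp: sums_iff)
  finally show ?thesis by (simp add: power2_eq_square)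
qed


context prob_space
begin

lemma nn_integral_power_count_le:
  assumes ind: "indep_vars (\<lambda>n. borel) X UNIV" and J: "finite J" and A: "A \<in> sets borel"
    and P: "\<And>n. n \<in> J \<Longrightarrow> emeasure M (X n -` A \<inter> space M) \<le> ennreal \<pi>" and pi0: "\<pi> \<ge> 0" and G: "G \<ge> 1"
  shows "(\<integral>\<^sup>+\<omega>. ennreal (G ^ card {n\<in>J. X n \<omega> \<in> A}) \<partial>M) \<le> ennreal (exp (G * \<pi> * card J))"
proof -
  have X[measurable]: "X n \<in> borel_measurable M" for n
    using ind by (auto simp: indep_vars_def)
  note A[measurable]
  let ?Y = "\<lambda>n \<omega>. if X n \<omega> \<in> A then ennreal G else 1"
  have "ennreal (G ^ card {n\<in>J. X n \<omega> \<in> A}) = (\<Prod>n\<in>J. ?Y n \<omega>)" for \<omega>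
    using J G by (simp add: prod.If_cases Int_def ennreal_power)
  then have "(\<integral>\<^sup>+\<omega>. ennreal (G ^ card {n\<in>J. X n \<omega> \<in> A}) \<partial>M) = (\<integral>\<^sup>+\<omega>. (\<Prod>n\<in>J. ?Y n \<omega>) \<partial>M)"
    by simp
  also have "\<dots> = (\<Prod>n\<in>J. \<integral>\<^sup>+\<omega>. ?Y n \<omega> \<partial>M)"
  proof (rule indep_vars_nn_integral[OF J])
    have "indep_vars (\<lambda>_. borel) (\<lambda>n \<omega>. (\<lambda>x. if x \<in> A then ennreal G else 1) (X n \<omega>)) J"
      using indep_vars_subset[OF ind subset_UNIV] by (rule indep_vars_compose2) simp
    then show "indep_vars (\<lambda>_. borel) ?Y J" by simp
  qed auto
  also have "\<dots> \<le> (\<Prod>n\<in>J. ennreal (exp (G * \<pi>)))"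
  proof (intro prod_mono_ennreal)
    fix n assume n: "n \<in> J"
    have "(\<integral>\<^sup>+\<omega>. ?Y n \<omega> \<partial>M) \<le> (\<integral>\<^sup>+\<omega>. 1 + ennreal G * indicator (X n -` A \<inter> space M) \<omega> \<partial>M)"
      by (intro nn_integral_mono) (auto simp: indicator_def)
    also have "\<dots> = 1 + ennreal G * emeasure M (X n -` A \<inter> space M)"
      by (simp add: nn_integral_add nn_integral_cmult emeasure_space_1)
    also have "\<dots> \<le> 1 + ennreal G * ennreal \<pi>"
      using P[OF n] by (intro add_left_mono mult_left_mono) auto
    also have "\<dots> = ennreal (1 + G * \<pi>)"
      using G pi0 by (simp add: ennreal_mult')
    also have "\<dots> \<le> ennreal (exp (G * \<pi>))"
      by (intro ennreal_leI exp_ge_add_one_self)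
    finally show "(\<integral>\<^sup>+\<omega>. ?Y n \<omega> \<partial>M) \<le> ennreal (exp (G * \<pi>))" .
  qed
  also have "\<dots> = ennreal (exp (G * \<pi> * card J))"
    by (simp add: ennreal_power exp_of_nat_mult[symmetric] mult.commute)
  finally show ?thesis .
qed

text \<open>The supremum over \<open>R\<close> of the sums of the \<open>f j\<close> with \<open>j \<in> D R\<close> has finite expectation by monotone
  convergence, so this one random variable is almost surely finite, and it bounds all \<open>f j\<close> at once.\<close>

lemma AE_bounded_if_sum_nn_integral_bounded:
  fixes f :: "'b \<Rightarrow> 'a \<Rightarrow> ennreal" and D :: "nat \<Rightarrow> 'b set"
  assumes f[measurable]: "\<And>j. f j \<in> borel_measurable M"
    and D: "incseq D" "\<And>R. finite (D R)"
    and bound: "\<And>R. (\<Sum>j\<in>D R. \<integral>\<^sup>+\<omega>. f j \<omega> \<partial>M) \<le> ennreal c"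
  shows "AE \<omega> in M. \<exists>W::real. \<forall>R. \<forall>j\<in>D R. f j \<omega> \<le> ennreal W"
proof -
  define \<Phi> where "\<Phi> \<omega> = (SUP R. \<Sum>j\<in>D R. f j \<omega>)" for \<omega>
  have "(\<integral>\<^sup>+\<omega>. \<Phi> \<omega> \<partial>M) = (SUP R. \<integral>\<^sup>+\<omega>. (\<Sum>j\<in>D R. f j \<omega>) \<partial>M)"
    unfolding \<Phi>_def using D
    by (intro nn_integral_monotone_convergence_SUP)
      (auto simp: incseq_def le_fun_def intro!: sum_mono2)
  also have "\<dots> \<le> ennreal c"
    using bound by (intro SUP_least) (simp add: nn_integral_sum)
  finally have fin: "(\<integral>\<^sup>+\<omega>. \<Phi> \<omega> \<partial>M) \<noteq> \<infinity>" using ennreal_less_top[of c] by (auto simp: top_unique)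
  have "\<Phi> \<in> borel_measurable M" unfolding \<Phi>_def by measurable
  then have "AE \<omega> in M. \<Phi> \<omega> \<noteq> \<infinity>" using fin by (rule nn_integral_PInf_AE)
  then show ?thesis
  proof (rule AE_mp, intro AE_I2 impI)
    fix \<omega> assume "\<Phi> \<omega> \<noteq> \<infinity>"
    then obtain W where W: "\<Phi> \<omega> = ennreal W" by (cases "\<Phi> \<omega>") auto
    have "f j \<omega> \<le> \<Phi> \<omega>" if "j \<in> D R" for j R
    proof -
      have "f j \<omega> \<le> (\<Sum>j\<in>D R. f j \<omega>)" using D that by (intro member_le_sum) auto
      also have "\<dots> \<le> \<Phi> \<omega>" unfolding \<Phi>_def by (rule SUP_upper) simp
      finally show ?thesis .
    qed
    then show "\<exists>W::real. \<forall>R. \<forall>j\<in>D R. f j \<omega> \<le> ennreal W" using W by auto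
  qed
qed

text \<open>A box with sides \<open>1 / 2 ^ k i\<close> receives on average \<open>(2 * a ^ 4) ^ \<Sum>l / 2 ^ \<Sum>k\<close> points of
  level \<open>l\<close>, up to a constant. The exponential moment of the count is taken at
  \<open>G = 2 * (1 / a\<^sup>2) ^ \<Sum>l\<close>, whose logarithm grows linearly with the level: this costs the
  difference between \<open>a ^ 4\<close> and \<open>a\<^sup>2\<close>, that is half of the room in the hypothesis, and gains a
  factor exponential in the level, with a rate proportional to the count, so that the number of boxes
  is compensated once the count exceeds a constant. It suffices to consider boxes centred at
  the points of a dyadic grid.\<close>

theorem AE_count_near_le:
  fixes X :: "nat \<Rightarrow> 'a \<Rightarrow> real ^ 'd" and lev :: "nat \<Rightarrow> 'd \<Rightarrow> nat" and a C :: real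
  assumes ind: "indep_vars (\<lambda>n. borel) X UNIV"
    and unif: "\<And>n. distr M borel (X n) = uniform_measure lborel unit_cube"
    and a: "0 < a" "a < 1" and C: "C \<ge> 0"
    and fin: "\<And>l. finite {n. lev n = l}"
    and sparse: "\<And>l. real (card {n. lev n = l}) \<le> C * (\<Prod>i\<in>UNIV. (2 * a ^ 4) ^ l i)"
  shows "AE \<omega> in M. \<exists>K>0. \<forall>p l k. (\<forall>i. k i \<le> l i) \<longrightarrow>
    real (card {q. lev q = l \<and> (\<forall>i. cmod (circle_exp (X q \<omega> $ i) - circle_exp (X p \<omega> $ i)) \<le> 2 / 2 ^ k i)})
      \<le> K * (1 + (\<Prod>i\<in>UNIV. (2 * a\<^sup>2) ^ l i / 2 ^ k i))"
proof -
  have X[measurable]: "X n \<in> borel_measurable M" for n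
    using ind by (auto simp: indep_vars_def)
  define J where "J l = {n. lev n = l}" for l
  have J: "finite (J l)" for l using fin by (simp add: J_def)
  \<comment> \<open>A point within \<open>2 / 2 ^ k\<close> of some \<open>p\<close> is within \<open>9 / 2 ^ k\<close> of the grid point below \<open>p\<close>, as \<open>p\<close> is within \<open>7 / 2 ^ k\<close> of it.\<close>
  define arc where "arc k c = {t. cmod (circle_exp t - circle_exp (real c / 2 ^ k)) \<le> 9 / 2 ^ k}" for k c :: nat
  define Q where "Q k c = {x :: real ^ 'd. \<forall>i. x $ i \<in> arc (k i) (c i)}" for k c :: "'d \<Rightarrow> nat"
  define G where "G l = 2 * (\<Prod>i\<in>UNIV. (1 / a\<^sup>2) ^ l i)" for l :: "'d \<Rightarrow> nat"
  define y where "y l k = (\<Prod>i\<in>UNIV. (2 * a\<^sup>2) ^ l i / 2 ^ k i)" for l k :: "'d \<Rightarrow> nat"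
  define B where "B = 2 * C * (\<Prod>i\<in>(UNIV :: 'd set). 27)"
  define cnt where "cnt l k c \<omega> = card {n\<in>J l. X n \<omega> \<in> Q k c}" for l k c \<omega>
  have y0: "y l k \<ge> 0" for l k using a by (auto simp: y_def intro!: prod_nonneg)
  have B0: "B \<ge> 0" using C by (simp add: B_def)
  have a2: "1 \<le> 1 / a\<^sup>2" using a by (simp add: power_le_one)
  have G1: "G l \<ge> 1" for l
  proof -
    have "1 \<le> (\<Prod>i\<in>UNIV. (1 / a\<^sup>2) ^ l i)" using a2 by (intro prod_ge_1 one_le_power)
    then show ?thesis by (simp add: G_def)
  qed
  have arc_borel: "arc k c \<in> sets borel" for k c
    unfolding arc_def circle_exp_def by measurable
  have Q_borel: "Q k c \<in> sets borel" for k c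
    unfolding Q_def by (rule emeasure_lborel_product_set(2)) (rule arc_borel)
  have PQ: "emeasure M (X n -` Q k c \<inter> space M) \<le> ennreal (\<Prod>i\<in>UNIV. 27 / 2 ^ k i)"
    if c: "\<And>i. c i < 2 ^ k i" for n k c
  proof -
    have "emeasure M (X n -` Q k c \<inter> space M) = (\<Prod>i\<in>UNIV. emeasure lborel (arc (k i) (c i) \<inter> {0..<1}))"
      unfolding Q_def by (rule emeasure_uniform_cube[OF X unif arc_borel])
    also have "\<dots> \<le> (\<Prod>i\<in>UNIV. ennreal (3 * (9 / 2 ^ k i)))"
      unfolding arc_def
    proof (intro prod_mono_ennreal emeasure_arc_le)
      fix i
      have "real (c i) \<le> real (2 ^ k i)" using c[of i] by (simp only: of_nat_le_iff less_imp_le)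
      then show "real (c i) / 2 ^ k i \<le> 1" by simp
    qed auto
    also have "\<dots> = ennreal (\<Prod>i\<in>UNIV. 27 / 2 ^ k i)" by (simp add: prod_ennreal)
    finally show ?thesis .
  qed
  have exponent: "G l * (\<Prod>i\<in>UNIV. 27 / 2 ^ k i) * real (card (J l)) \<le> B * y l k" for l k
  proof -
    have "G l * (\<Prod>i\<in>UNIV. 27 / 2 ^ k i) * real (card (J l))
      \<le> G l * (\<Prod>i\<in>UNIV. 27 / 2 ^ k i) * (C * (\<Prod>i\<in>UNIV. (2 * a ^ 4) ^ l i))"
      using sparse[of l] G1[of l] by (intro mult_left_mono) (auto simp: J_def intro!: prod_nonneg mult_nonneg_nonneg)
    also have "\<dots> = 2 * C * ((\<Prod>i\<in>UNIV. (1 / a\<^sup>2) ^ l i) * (\<Prod>i\<in>UNIV. 27 / 2 ^ k i) * (\<Prod>i\<in>UNIV. (2 * a ^ 4) ^ l i))"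
      by (simp add: G_def)
    also have "(\<Prod>i\<in>UNIV. (1 / a\<^sup>2) ^ l i) * (\<Prod>i\<in>UNIV. 27 / 2 ^ k i) * (\<Prod>i\<in>UNIV. (2 * a ^ 4) ^ l i)
      = (\<Prod>i\<in>UNIV. 27 * ((2 * a\<^sup>2) ^ l i / 2 ^ k i))"
      unfolding prod.distrib[symmetric]
    proof (intro prod.cong refl)
      fix i
      have "1 / a\<^sup>2 * (2 * a ^ 4) = 2 * a\<^sup>2" using a by (simp add: field_simps flip: power_add)
      then have "(1 / a\<^sup>2) ^ l i * (2 * a ^ 4) ^ l i = (2 * a\<^sup>2) ^ l i"
        by (metis power_mult_distrib)
      then show "(1 / a\<^sup>2) ^ l i * (27 / 2 ^ k i) * (2 * a ^ 4) ^ l i = 27 * ((2 * a\<^sup>2) ^ l i / 2 ^ k i)"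
        by (simp add: mult_ac)
    qed
    also have "\<dots> = (\<Prod>i\<in>(UNIV :: 'd set). 27) * y l k"
      unfolding y_def prod.distrib ..
    finally show ?thesis by (simp add: B_def)
  qed
  define f where "f j \<omega> = (let l = \<lambda>i. fst (j i); k = \<lambda>i. fst (snd (j i)); c = \<lambda>i. snd (snd (j i)) in
      ennreal ((\<Prod>i\<in>UNIV. (1 / 8) ^ l i) * exp (- (B * y l k)) * G l ^ cnt l k c \<omega>))"
    for j :: "'d \<Rightarrow> nat \<times> nat \<times> nat" and \<omega>
  define cells where "cells R = (SIGMA l:{..R}. SIGMA k:{..l}. {..<2 ^ k :: nat})" for R :: nat
  define D where "D R = Pi\<^sub>E (UNIV :: 'd set) (\<lambda>_. cells R)" for R
  have fincells: "finite (cells R)" for R by (simp add: cells_def)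
  have cnt_meas[measurable]: "(\<lambda>\<omega>. G l ^ cnt l k c \<omega>) \<in> borel_measurable M" for l k c
  proof -
    have "G l ^ cnt l k c \<omega> = (\<Prod>n\<in>J l. if X n \<omega> \<in> Q k c then G l else 1)" for \<omega>
      using J by (simp add: cnt_def prod.If_cases Int_def)
    moreover have "(\<lambda>\<omega>. \<Prod>n\<in>J l. if X n \<omega> \<in> Q k c then G l else 1) \<in> borel_measurable M"
      using Q_borel by measurable
    ultimately show ?thesis by simp
  qed
  have "AE \<omega> in M. \<exists>W::real. \<forall>R. \<forall>j\<in>D R. f j \<omega> \<le> ennreal W"
  proof (rule AE_bounded_if_sum_nn_integral_bounded)
    show "f j \<in> borel_measurable M" for j unfolding f_def Let_def by measurable
    show "incseq D" unfolding D_def cells_def incseq_def by (intro allI impI PiE_mono) auto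
    show "finite (D R)" for R unfolding D_def using fincells by (intro finite_PiE) auto
    fix R
    have "(\<integral>\<^sup>+\<omega>. f j \<omega> \<partial>M) \<le> ennreal (\<Prod>i\<in>UNIV. (1 / 8) ^ fst (j i))" if j: "j \<in> D R" for j
    proof -
      let ?l = "\<lambda>i. fst (j i)" and ?k = "\<lambda>i. fst (snd (j i))" and ?c = "\<lambda>i. snd (snd (j i))"
      let ?w = "(\<Prod>i\<in>UNIV. (1 / 8) ^ ?l i) * exp (- (B * y ?l ?k))"
      have c: "?c i < 2 ^ ?k i" for i
      proof -
        have "j i \<in> cells R" using j by (auto simp: D_def)
        then show ?thesis by (auto simp: cells_def)
      qed
      have "(\<integral>\<^sup>+\<omega>. f j \<omega> \<partial>M) = (\<integral>\<^sup>+\<omega>. ennreal ?w * ennreal (G ?l ^ cnt ?l ?k ?c \<omega>) \<partial>M)"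
        unfolding f_def Let_def using G1[of ?l]
        by (intro nn_integral_cong ennreal_mult) (auto intro!: prod_nonneg mult_nonneg_nonneg)
      also have "\<dots> = ennreal ?w * (\<integral>\<^sup>+\<omega>. ennreal (G ?l ^ cnt ?l ?k ?c \<omega>) \<partial>M)"
        by (intro nn_integral_cmult) measurable
      also have "\<dots> \<le> ennreal ?w * ennreal (exp (G ?l * (\<Prod>i\<in>UNIV. 27 / 2 ^ ?k i) * card (J ?l)))"
        unfolding cnt_def using PQ[OF c] G1
        by (intro mult_left_mono nn_integral_power_count_le[OF ind J Q_borel]) (auto intro!: prod_nonneg)
      also have "\<dots> \<le> ennreal ?w * ennreal (exp (B * y ?l ?k))"
        using exponent[of ?l ?k] by (intro mult_left_mono ennreal_leI) auto
      also have "\<dots> = ennreal (\<Prod>i\<in>UNIV. (1 / 8) ^ ?l i)"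
        by (subst ennreal_mult[symmetric]) (auto intro!: prod_nonneg mult_nonneg_nonneg simp: mult.assoc simp flip: exp_add)
      finally show ?thesis .
    qed
    then have "(\<Sum>j\<in>D R. \<integral>\<^sup>+\<omega>. f j \<omega> \<partial>M) \<le> (\<Sum>j\<in>D R. ennreal (\<Prod>i\<in>UNIV. (1 / 8) ^ fst (j i)))"
      by (rule sum_mono)
    also have "\<dots> = ennreal (\<Sum>j\<in>D R. (\<Prod>i\<in>UNIV. (1 / 8) ^ fst (j i)))"
      by (intro sum_ennreal prod_nonneg) auto
    also have "(\<Sum>j\<in>D R. (\<Prod>i\<in>UNIV. (1 / 8 :: real) ^ fst (j i))) = (\<Prod>i\<in>(UNIV :: 'd set). \<Sum>x\<in>cells R. (1 / 8) ^ fst x)"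
      unfolding D_def by (rule prod_sum_PiE[OF finite fincells, symmetric])
    also have "\<dots> \<le> (\<Prod>i\<in>(UNIV :: 'd set). 2)"
      using sum_cell_weights_le[of R] by (intro prod_mono) (auto simp: cells_def case_prod_unfold intro!: sum_nonneg)
    finally show "(\<Sum>j\<in>D R. \<integral>\<^sup>+\<omega>. f j \<omega> \<partial>M) \<le> ennreal (\<Prod>i\<in>(UNIV :: 'd set). 2)"
      by (simp add: ennreal_leI)
  qed
  then show ?thesis
  proof (rule AE_mp, intro AE_I2 impI)
    fix \<omega> assume "\<exists>W::real. \<forall>R. \<forall>j\<in>D R. f j \<omega> \<le> ennreal W"
    then obtain W :: real where W: "\<And>R j. j \<in> D R \<Longrightarrow> f j \<omega> \<le> ennreal W" by blast
    define W' where "W' = max W 1"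
    have W': "W' \<ge> 1" "\<And>R j. j \<in> D R \<Longrightarrow> f j \<omega> \<le> ennreal W'"
      using order_trans[OF W ennreal_leI[of W W']] by (auto simp: W'_def)
    \<comment> \<open>Taking logarithms turns the bound on \<open>G ^ cnt\<close> into one on \<open>cnt * ln (G l)\<close>, and \<open>ln (G l)\<close> is at least \<open>\<tau>\<close> times one plus the sum of the levels.\<close>
    define \<tau> where "\<tau> = min (ln 2) (ln (1 / a\<^sup>2))"
    have "a\<^sup>2 < 1" using a by (simp add: abs_square_less_1)
    then have a2': "1 < 1 / a\<^sup>2" using a by (simp add: field_simps)
    have tau: "\<tau> > 0" using a2' by (auto simp: \<tau>_def ln_gt_zero)
    define K where "K = (ln W' + ln 8 + B) / \<tau> + 1"
    have nn: "0 \<le> ln W' + ln 8" using W' by (intro add_nonneg_nonneg) auto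
    have K: "K > 0" using tau nn B0 by (auto simp: K_def intro!: add_nonneg_pos divide_nonneg_pos)
    have "real (card {q. lev q = l \<and> (\<forall>i. cmod (circle_exp (X q \<omega> $ i) - circle_exp (X p \<omega> $ i)) \<le> 2 / 2 ^ k i)})
      \<le> K * (1 + y l k)" if kl: "\<forall>i. k i \<le> l i" for p l k
    proof -
      define s where "s = sum l UNIV"
      define c where "c i = nat \<lfloor>2 ^ k i * frac (X p \<omega> $ i)\<rfloor>" for i
      have c: "c i < 2 ^ k i \<and> cmod (circle_exp (X p \<omega> $ i) - circle_exp (real (c i) / 2 ^ k i)) \<le> 7 / 2 ^ k i" for i
      proof
        let ?t = "frac (X p \<omega> $ i)"
        have t: "0 \<le> ?t" "?t < 1" by (auto simp: frac_lt_1)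
        have c1: "real (c i) \<le> 2 ^ k i * ?t" "2 ^ k i * ?t < real (c i) + 1"
          using t by (auto simp: c_def)
        have "2 ^ k i * ?t < 2 ^ k i" using t by simp
        then have "real (c i) < 2 ^ k i" using c1(1) by (rule order.strict_trans1[rotated])
        then show "c i < 2 ^ k i"
          by (metis of_nat_less_iff of_nat_numeral of_nat_power)
        have "\<bar>?t - real (c i) / 2 ^ k i\<bar> \<le> 1 / 2 ^ k i"
        proof (rule abs_leI)
          have "?t \<le> (real (c i) + 1) / 2 ^ k i" using c1(2) by (simp add: field_simps)
          then show "?t - real (c i) / 2 ^ k i \<le> 1 / 2 ^ k i" by (simp add: add_divide_distrib)
          have "real (c i) / 2 ^ k i \<le> ?t" using c1(1) by (simp add: field_simps)
          moreover have "(0::real) \<le> 1 / 2 ^ k i" by simp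
          ultimately show "- (?t - real (c i) / 2 ^ k i) \<le> 1 / 2 ^ k i" by linarith
        qed
        then have "7 * \<bar>?t - real (c i) / 2 ^ k i\<bar> \<le> 7 / 2 ^ k i" by simp
        then show "cmod (circle_exp (X p \<omega> $ i) - circle_exp (real (c i) / 2 ^ k i)) \<le> 7 / 2 ^ k i"
          using norm_circle_exp_diff_le[of ?t "real (c i) / 2 ^ k i"] by (simp add: circle_exp_frac)
      qed
      define j where "j i = (l i, k i, c i)" for i
      have "j \<in> D s"
        using kl c by (auto simp: D_def j_def cells_def s_def intro!: member_le_sum)
      then have "f j \<omega> \<le> ennreal W'" by (rule W'(2))
      then have "(\<Prod>i\<in>UNIV. (1 / 8) ^ l i) * exp (- (B * y l k)) * G l ^ cnt l k c \<omega> \<le> W'"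
        using W'(1) by (simp add: f_def j_def)
      then have "ln ((\<Prod>i\<in>UNIV. (1 / 8) ^ l i) * exp (- (B * y l k)) * G l ^ cnt l k c \<omega>) \<le> ln W'"
        using G1[of l] W'(1) by (subst ln_le_cancel_iff) (auto intro!: mult_pos_pos prod_pos)
      also have "(\<Prod>i\<in>UNIV. (1 / 8 :: real) ^ l i) = (1 / 8) ^ s"
        by (simp add: s_def power_sum)
      also have "ln ((1 / 8) ^ s * exp (- (B * y l k)) * G l ^ cnt l k c \<omega>)
          = - (real s * ln 8) - B * y l k + cnt l k c \<omega> * ln (G l)"
        using G1[of l] by (simp add: ln_mult ln_realpow ln_div)
      finally have "cnt l k c \<omega> * ln (G l) \<le> ln W' + real s * ln 8 + B * y l k" by simp
      also have "ln (G l) = ln 2 + s * ln (1 / a\<^sup>2)"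
        using a by (simp add: G_def s_def ln_mult ln_realpow flip: power_sum)
      finally have le: "cnt l k c \<omega> * (ln 2 + s * ln (1 / a\<^sup>2)) \<le> ln W' + real s * ln 8 + B * y l k" .
      have "cnt l k c \<omega> * (\<tau> * (1 + real s)) \<le> cnt l k c \<omega> * (ln 2 + s * ln (1 / a\<^sup>2))"
      proof (intro mult_left_mono)
        have "\<tau> * 1 + real s * \<tau> \<le> ln 2 + s * ln (1 / a\<^sup>2)"
          by (intro add_mono mult_left_mono) (auto simp: \<tau>_def)
        then show "\<tau> * (1 + real s) \<le> ln 2 + s * ln (1 / a\<^sup>2)" by (simp add: algebra_simps)
      qed auto
      also note le
      also have "ln W' + real s * ln 8 + B * y l k \<le> (ln W' + ln 8 + B) * (1 + y l k) * (1 + real s)"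
      proof -
        have u: "0 \<le> ln W'" "0 \<le> ln (8::real)" using W' by auto
        have "(ln W' + ln 8 + B) * (1 + y l k) * (1 + real s)
          = ln W' + real s * ln 8 + B * y l k + (ln W' * (y l k + real s * (1 + y l k)) + ln 8 * (1 + y l k + real s * y l k)
            + B * (1 + real s * (1 + y l k)))"
          by (simp add: algebra_simps)
        moreover have "0 \<le> ln W' * (y l k + real s * (1 + y l k)) + ln 8 * (1 + y l k + real s * y l k)
            + B * (1 + real s * (1 + y l k))"
          using u y0[of l k] B0 by (intro add_nonneg_nonneg mult_nonneg_nonneg) auto
        ultimately show ?thesis by linarith
      qed
      finally have "(cnt l k c \<omega> * \<tau>) * (1 + real s) \<le> ((ln W' + ln 8 + B) * (1 + y l k)) * (1 + real s)"
        by (simp add: mult_ac)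
      then have "cnt l k c \<omega> * \<tau> \<le> (ln W' + ln 8 + B) * (1 + y l k)"
        by (rule mult_right_le_imp_le) simp
      then have "cnt l k c \<omega> \<le> (ln W' + ln 8 + B) / \<tau> * (1 + y l k)"
        using tau by (simp add: field_simps)
      also have "\<dots> \<le> K * (1 + y l k)"
        using y0[of l k] by (intro mult_right_mono) (auto simp: K_def)
      finally have cntle: "real (cnt l k c \<omega>) \<le> K * (1 + y l k)" .
      have "card {q. lev q = l \<and> (\<forall>i. cmod (circle_exp (X q \<omega> $ i) - circle_exp (X p \<omega> $ i)) \<le> 2 / 2 ^ k i)}
        \<le> cnt l k c \<omega>"
        unfolding cnt_def
      proof (intro card_mono subsetI)
        show "finite {n \<in> J l. X n \<omega> \<in> Q k c}" using J by simp
        fix q assume q: "q \<in> {q. lev q = l \<and> (\<forall>i. cmod (circle_exp (X q \<omega> $ i) - circle_exp (X p \<omega> $ i)) \<le> 2 / 2 ^ k i)}"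
        have "cmod (circle_exp (X q \<omega> $ i) - circle_exp (real (c i) / 2 ^ k i)) \<le> 2 / 2 ^ k i + 7 / 2 ^ k i" for i
        proof -
          have "cmod (circle_exp (X q \<omega> $ i) - circle_exp (real (c i) / 2 ^ k i))
            \<le> cmod (circle_exp (X q \<omega> $ i) - circle_exp (X p \<omega> $ i))
              + cmod (circle_exp (X p \<omega> $ i) - circle_exp (real (c i) / 2 ^ k i))"
            using norm_triangle_ineq[of "circle_exp (X q \<omega> $ i) - circle_exp (X p \<omega> $ i)"
                "circle_exp (X p \<omega> $ i) - circle_exp (real (c i) / 2 ^ k i)"] by simp
          also have "\<dots> \<le> 2 / 2 ^ k i + 7 / 2 ^ k i"
            using q c[of i] by (intro add_mono) auto
          finally show ?thesis .
        qed
        then show "q \<in> {n \<in> J l. X n \<omega> \<in> Q k c}"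
          using q by (simp add: J_def Q_def arc_def)
      qed
      then show ?thesis using cntle by linarith
    qed
    then show "\<exists>K>0. \<forall>p l k. (\<forall>i. k i \<le> l i) \<longrightarrow>
      real (card {q. lev q = l \<and> (\<forall>i. cmod (circle_exp (X q \<omega> $ i) - circle_exp (X p \<omega> $ i)) \<le> 2 / 2 ^ k i)})
      \<le> K * (1 + (\<Prod>i\<in>UNIV. (2 * a\<^sup>2) ^ l i / 2 ^ k i))"
      using K unfolding y_def by blast
  qed
qed

end

section \<open>Balls in bins\<close>

definition small_fibre_maps :: "'a set \<Rightarrow> 'b set \<Rightarrow> nat \<Rightarrow> ('a \<Rightarrow> 'b) set"
  where "small_fibre_maps J S k = {f \<in> J \<rightarrow>\<^sub>E S. \<forall>b\<in>S. card {n\<in>J. f n = b} < k}"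

lemma finite_small_fibre_maps: "finite J \<Longrightarrow> finite S \<Longrightarrow> finite (small_fibre_maps J S k)"
  unfolding small_fibre_maps_def by (intro finite_subset[OF _ finite_PiE[of J "\<lambda>_. S"]]) auto

text \<open>A map is determined by its fibre over \<open>b\<close> and its restriction to the complement of this fibre.\<close>

lemma card_small_fibre_maps_insert_le:
  assumes J: "finite J" and S: "finite S" and b: "b \<notin> S"
  shows "card (small_fibre_maps J (insert b S) k)
    \<le> (\<Sum>A | A \<subseteq> J \<and> card A < k. card (small_fibre_maps (J - A) S k))"
proof -
  define \<Phi> where "\<Phi> f = ({n\<in>J. f n = b}, restrict f {n\<in>J. f n \<noteq> b})" for f :: "'a \<Rightarrow> 'b"
  let ?T = "SIGMA A:{A. A \<subseteq> J \<and> card A < k}. small_fibre_maps (J - A) S k"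
  have "inj_on \<Phi> (small_fibre_maps J (insert b S) k)"
  proof (rule inj_onI)
    fix f g assume f: "f \<in> small_fibre_maps J (insert b S) k" and g: "g \<in> small_fibre_maps J (insert b S) k"
      and eq: "\<Phi> f = \<Phi> g"
    show "f = g"
    proof
      fix n
      note eq' = eq[unfolded \<Phi>_def prod.inject]
      note 1 = conjunct1[OF eq'] and 2 = fun_cong[OF conjunct2[OF eq'], of n]
      show "f n = g n"
      proof (cases "n \<in> J")
        case True
        have "f n = b \<longleftrightarrow> g n = b" using 1 True by blast
        then show ?thesis using 2 True by (cases "f n = b") simp_all
      next
        case False
        have "f \<in> extensional J" "g \<in> extensional J"
          using f g by (simp_all add: small_fibre_maps_def PiE_def)
        then show ?thesis using False by (simp add: extensional_def)
      qed
    qed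
  qed
  moreover have "\<Phi> ` small_fibre_maps J (insert b S) k \<subseteq> ?T"
  proof
    fix x assume "x \<in> \<Phi> ` small_fibre_maps J (insert b S) k"
    then obtain f where f: "f \<in> small_fibre_maps J (insert b S) k" and x: "x = \<Phi> f" by auto
    have eq: "J - {n\<in>J. f n = b} = {n\<in>J. f n \<noteq> b}" by auto
    have mem: "restrict f {n\<in>J. f n \<noteq> b} \<in> small_fibre_maps {n\<in>J. f n \<noteq> b} S k"
    proof -
      have "{n \<in> {n\<in>J. f n \<noteq> b}. restrict f {n\<in>J. f n \<noteq> b} n = c} = {n\<in>J. f n = c}" if "c \<in> S" for c
        using that b by auto
      then show ?thesis using f by (auto simp: small_fibre_maps_def)
    qed
    have "card {n\<in>J. f n = b} < k" using f by (simp add: small_fibre_maps_def)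
    then show "x \<in> ?T" unfolding x \<Phi>_def mem_Sigma_iff eq using mem by blast
  qed
  moreover have "finite ?T"
    using J S by (intro finite_SigmaI finite_small_fibre_maps) auto
  ultimately have "card (small_fibre_maps J (insert b S) k) \<le> card ?T"
    by (intro card_inj_on_le)
  also have "\<dots> = (\<Sum>A | A \<subseteq> J \<and> card A < k. card (small_fibre_maps (J - A) S k))"
    using J S by (intro card_SigmaI) (auto intro: finite_small_fibre_maps)
  finally show ?thesis .
qed

text \<open>The number of maps, divided by \<open>fact (card J)\<close>, is the coefficient of \<open>x ^ card J\<close> in the
  polynomial \<open>(\<Sum>j<k. x ^ j / fact j) ^ card S\<close>, which has nonnegative coefficients; one
  coefficient is bounded by the value of the polynomial.\<close>

lemma card_small_fibre_maps_le:
  fixes x :: real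
  assumes "finite S" "finite J" "x \<ge> 0"
  shows "card (small_fibre_maps J S k) * x ^ card J \<le> fact (card J) * (\<Sum>j<k. x ^ j / fact j) ^ card S"
  using assms(1,2)
proof (induction S arbitrary: J rule: finite_induct)
  case empty
  show ?case
  proof (cases "J = {}")
    case True
    have "small_fibre_maps J ({} :: 'a set) k \<subseteq> {\<lambda>_. undefined}"
      using True by (auto simp: small_fibre_maps_def)
    then have "card (small_fibre_maps J ({} :: 'a set) k) \<le> 1"
      using card_mono[of "{\<lambda>_. undefined}" "small_fibre_maps J ({} :: 'a set) k"] by simp
    then show ?thesis using True by simp
  next
    case False
    then have "small_fibre_maps J ({} :: 'a set) k = {}"
      by (auto simp: small_fibre_maps_def PiE_def Pi_def)
    then show ?thesis by simp
  qed
next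
  case (insert b S)
  define E where "E = (\<Sum>j<k. x ^ j / fact j)"
  let ?A = "{A. A \<subseteq> J \<and> card A < k}"
  have finA: "finite ?A" using insert.prems by simp
  have E: "E \<ge> 0" using assms(3) by (auto simp: E_def intro!: sum_nonneg)
  have "real (card (small_fibre_maps J (insert b S) k)) * x ^ card J
     \<le> real (\<Sum>A\<in>?A. card (small_fibre_maps (J - A) S k)) * x ^ card J"
    using insert assms(3) card_small_fibre_maps_insert_le[of J S b k]
    by (intro mult_right_mono) (auto simp del: of_nat_sum)
  also have "\<dots> = (\<Sum>A\<in>?A. card (small_fibre_maps (J - A) S k) * x ^ card (J - A) * x ^ card A)"
  proof -
    have "x ^ card J = x ^ card (J - A) * x ^ card A" if "A \<in> ?A" for A
      using that insert.prems card_mono[of J A] finite_subset[of A J]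
      by (auto simp: card_Diff_subset simp flip: power_add)
    then show ?thesis by (simp add: sum_distrib_right mult.assoc)
  qed
  also have "\<dots> \<le> (\<Sum>A\<in>?A. fact (card (J - A)) * E ^ card S * x ^ card A)"
    using insert assms(3) by (intro sum_mono mult_right_mono) (auto simp: E_def)
  also have "\<dots> = (\<Sum>A\<in>?A. fact (card J - card A) * E ^ card S * x ^ card A)"
    using insert.prems by (intro sum.cong) (auto simp: card_Diff_subset finite_subset)
  also have "\<dots> = (\<Sum>j<k. \<Sum>A | A \<in> ?A \<and> card A = j. fact (card J - card A) * E ^ card S * x ^ card A)"
    using finA by (subst sum.group) auto
  also have "\<dots> = (\<Sum>j<k. (card J choose j) * (fact (card J - j) * E ^ card S * x ^ j))"
  proof (intro sum.cong refl)
    fix j assume "j \<in> {..<k}"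
    then have "{A. A \<in> ?A \<and> card A = j} = {A. A \<subseteq> J \<and> card A = j}" by auto
    then show "(\<Sum>A | A \<in> ?A \<and> card A = j. fact (card J - card A) * E ^ card S * x ^ card A)
      = (card J choose j) * (fact (card J - j) * E ^ card S * x ^ j)"
      using n_subsets[OF insert.prems, of j] by simp
  qed
  also have "\<dots> \<le> (\<Sum>j<k. fact (card J) * E ^ card S * (x ^ j / fact j))"
  proof (intro sum_mono)
    fix j
    have "real (card J choose j) * fact (card J - j) \<le> fact (card J) / fact j"
      by (cases "j \<le> card J") (simp_all add: binomial_fact binomial_eq_0)
    then have "real (card J choose j) * fact (card J - j) * (E ^ card S * x ^ j) \<le> fact (card J) / fact j * (E ^ card S * x ^ j)"
      using E assms(3) by (intro mult_right_mono) auto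
    then show "(card J choose j) * (fact (card J - j) * E ^ card S * x ^ j) \<le> fact (card J) * E ^ card S * (x ^ j / fact j)"
      by (simp add: mult_ac)
  qed
  also have "\<dots> = fact (card J) * E ^ card S * E"
    unfolding E_def sum_distrib_left ..
  also have "\<dots> = fact (card J) * E ^ card (insert b S)"
    using insert.hyps by simp
  finally show ?case by (simp add: E_def)
qed

text \<open>A weak form of Stirling's upper bound.\<close>

lemma fact_mult_exp_le:
  assumes "n \<ge> 1" shows "fact n * exp (real n) \<le> 3 * real n * real n ^ n"
proof -
  have "fact n * exp (real n) \<le> exp 1 * real n * real n ^ n"
    using assms
  proof (induction n rule: nat_induct_at_least)
    case base
    then show ?case by simp
  next
    case (Suc n)
    have "1 - 1 / real (Suc n) \<le> exp (- (1 / real (Suc n)))"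
      using exp_ge_add_one_self[of "- (1 / real (Suc n))"] by simp
    then have "(real n / real (Suc n)) ^ Suc n \<le> exp (- (1 / real (Suc n))) ^ Suc n"
      by (intro power_mono) (auto simp: field_simps)
    also have "\<dots> = exp (- 1)" by (simp only: exp_of_nat_mult[symmetric]) simp
    finally have *: "(real n / real (Suc n)) ^ Suc n \<le> exp (- 1)" .
    have **: "exp 1 * real n ^ Suc n \<le> real (Suc n) ^ Suc n"
    proof -
      have "real n ^ Suc n \<le> exp (- 1) * real (Suc n) ^ Suc n"
        using * unfolding power_divide by (subst (asm) pos_divide_le_eq) simp_all
      then have "exp 1 * real n ^ Suc n \<le> exp 1 * (exp (- 1) * real (Suc n) ^ Suc n)"
        by (intro mult_left_mono) auto
      also have "\<dots> = (exp 1 * exp (- 1)) * real (Suc n) ^ Suc n" by (simp only: mult.assoc)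
      also have "exp 1 * exp (- 1) = (1 :: real)" by (simp flip: exp_add)
      finally show ?thesis by simp
    qed
    have "fact (Suc n) * exp (real (Suc n)) = real (Suc n) * exp 1 * (fact n * exp (real n))"
      by (simp add: exp_add)
    also have "\<dots> \<le> real (Suc n) * exp 1 * (exp 1 * real n * real n ^ n)"
      using Suc by (intro mult_left_mono) auto
    also have "\<dots> = exp 1 * real (Suc n) * (exp 1 * real n ^ Suc n)" by simp
    also have "\<dots> \<le> exp 1 * real (Suc n) * real (Suc n) ^ Suc n"
      using ** by (intro mult_left_mono) auto
    finally show ?case .
  qed
  also have "\<dots> \<le> 3 * real n * real n ^ n"
    using exp_le by (intro mult_right_mono) auto
  finally show ?thesis .
qed

text \<open>Relative to \<open>exp x\<close>, the sum is the probability that a Poisson variable of mean \<open>x\<close> is below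
  \<open>k\<close>; the value \<open>k\<close> alone takes away at least \<open>x ^ k / (3 * fact k)\<close>, because \<open>exp (- x) \<ge> 1 / 3\<close>.\<close>

lemma truncated_exp_le:
  fixes x :: real
  assumes "0 \<le> x" "x \<le> 1"
  shows "(\<Sum>j<k. x ^ j / fact j) \<le> exp (x - x ^ k / (3 * fact k))"
proof -
  have "(\<Sum>j<Suc k. x ^ j / fact j) \<le> exp x"
  proof -
    have "(\<Sum>j\<in>{..<Suc k}. inverse (fact j) *\<^sub>R x ^ j) \<le> (\<Sum>j. inverse (fact j) *\<^sub>R x ^ j)"
      using assms by (intro sum_le_suminf summable_exp_generic) auto
    then show ?thesis by (simp add: exp_def divide_inverse mult_ac)
  qed
  then have "(\<Sum>j<k. x ^ j / fact j) \<le> exp x - x ^ k / fact k" by simp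
  also have "\<dots> \<le> exp x - x ^ k / fact k * (exp x / 3)"
  proof -
    have "exp x \<le> exp 1" using assms by simp
    then have "exp x / 3 \<le> 1" using exp_le by linarith
    then have "x ^ k / fact k * (exp x / 3) \<le> x ^ k / fact k * 1"
      using assms by (intro mult_left_mono) auto
    then show ?thesis by simp
  qed
  also have "\<dots> = exp x * (1 + - (x ^ k / (3 * fact k)))" by (simp add: field_simps)
  also have "\<dots> \<le> exp x * exp (- (x ^ k / (3 * fact k)))"
    by (intro mult_left_mono exp_ge_add_one_self) auto
  also have "\<dots> = exp (x - x ^ k / (3 * fact k))" by (simp flip: exp_add)
  finally show ?thesis .
qed

text \<open>The coefficient bound is used at \<open>x = card J / card S\<close>, the mean number of balls per bin, which
  minimises \<open>exp (card S * x) / x ^ card J\<close>. Then the powers of \<open>card J\<close> and the exponential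
  \<open>exp (card J)\<close> cancel against the factorial, and what remains is the probability of
  \<open>card S\<close> independent Poisson variables of mean \<open>x\<close> all being below \<open>k\<close>.\<close>

lemma small_fibre_fraction_le:
  assumes S: "finite S" and J: "finite J" "1 \<le> card J" "card J \<le> card S"
  shows "card (small_fibre_maps J S k) / real (card S) ^ card J
    \<le> 3 * real (card S) * exp (- (real (card S) * (real (card J) / real (card S)) ^ k / (3 * fact k)))"
proof -
  define n M where "n = card J" and "M = card S"
  define x where "x = real n / real M"
  have n: "1 \<le> n" "n \<le> M" using J by (auto simp: n_def M_def)
  have x: "0 < x" "x \<le> 1" and xM: "M * x = n" using n by (auto simp: x_def)
  have "card (small_fibre_maps J S k) * x ^ n \<le> fact n * (\<Sum>j<k. x ^ j / fact j) ^ M"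
    using card_small_fibre_maps_le[OF S J(1), of x] x by (simp add: n_def M_def)
  also have "\<dots> \<le> fact n * exp (x - x ^ k / (3 * fact k)) ^ M"
    using x by (intro mult_left_mono power_mono truncated_exp_le sum_nonneg) auto
  also have "\<dots> = fact n * exp (real n) * exp (- (M * x ^ k / (3 * fact k)))"
  proof -
    have "exp (x - x ^ k / (3 * fact k)) ^ M = exp (M * (x - x ^ k / (3 * fact k)))"
      by (simp only: exp_of_nat_mult)
    also have "M * (x - x ^ k / (3 * fact k)) = real n + - (M * x ^ k / (3 * fact k))"
      using xM by (simp add: right_diff_distrib)
    finally show ?thesis by (simp only: exp_add mult.assoc)
  qed
  also have "\<dots> \<le> 3 * real n * real n ^ n * exp (- (M * x ^ k / (3 * fact k)))"
    using fact_mult_exp_le[OF n(1)] by (intro mult_right_mono) auto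
  finally have "card (small_fibre_maps J S k) \<le> 3 * real n * real n ^ n * exp (- (M * x ^ k / (3 * fact k))) / x ^ n"
    using x by (simp add: field_simps)
  also have "\<dots> = 3 * real n * real M ^ n * exp (- (M * x ^ k / (3 * fact k)))"
    using n by (simp add: x_def power_divide)
  finally have "card (small_fibre_maps J S k) / real M ^ n \<le> 3 * real n * exp (- (M * x ^ k / (3 * fact k)))"
    using n by (simp add: field_simps)
  also have "\<dots> \<le> 3 * real M * exp (- (M * x ^ k / (3 * fact k)))"
    using n by (intro mult_right_mono) auto
  finally show ?thesis by (simp add: n_def M_def x_def)
qed

lemma small_fibre_maps_empty:
  assumes S: "finite S" "S \<noteq> {}" and J: "finite J" "k * card S \<le> card J"
  shows "small_fibre_maps J S k = {}"
proof (rule ccontr)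
  assume "small_fibre_maps J S k \<noteq> {}"
  then obtain f where "f \<in> small_fibre_maps J S k" by blast
  then have f: "f \<in> J \<rightarrow>\<^sub>E S" "\<And>b. b \<in> S \<Longrightarrow> card {n\<in>J. f n = b} < k"
    by (simp_all add: small_fibre_maps_def)
  have "card J = (\<Sum>b\<in>S. card {n\<in>J. f n = b})"
    using sum.group[OF J(1) S(1), of f "\<lambda>_. 1 :: nat"] f(1) by (simp add: PiE_iff image_subset_iff)
  also have "\<dots> < (\<Sum>b\<in>S. k)" using f(2) S by (intro sum_strict_mono) auto
  finally show False using J by (simp add: mult.commute)
qed

text \<open>With \<open>M\<close> bins and \<open>n \<ge> M powr (1 - 1 / (2 * k))\<close> balls, the number \<open>M * (n / M) ^ k\<close> of bins with
  \<open>k\<close> balls to be expected is at least \<open>sqrt M\<close>, so that small fibres are improbable once \<open>M\<close>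
  exceeds some \<open>M0\<close>. For fewer bins the constant \<open>c \<ge> k * M0\<close> makes small fibres impossible by
  the pigeonhole principle.\<close>

lemma exists_subset_few_small_fibre_maps:
  fixes \<delta> :: real
  assumes k: "k \<ge> 1" and \<delta>: "\<delta> > 0"
  shows "\<exists>c>0. \<forall>A :: 'a set. \<forall>S :: 'b set. finite S \<longrightarrow> S \<noteq> {} \<longrightarrow>
    infinite A \<or> c * real (card S) powr (1 - 1 / (2 * real k)) < real (card A) \<longrightarrow>
    (\<exists>J\<subseteq>A. finite J \<and> J \<noteq> {} \<and> card (small_fibre_maps J S k) / real (card S) ^ card J < \<delta>)"
proof -
  have "((\<lambda>M. 3 * M * exp (- (sqrt M / (3 * fact k)))) \<longlongrightarrow> (0::real)) at_top"
  proof -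
    have "((\<lambda>M. 3 * M * exp (- (sqrt M / c))) \<longlongrightarrow> (0::real)) at_top" if "c > 0" for c :: real
      using that by real_asymp
    then show ?thesis by simp
  qed
  then have "eventually (\<lambda>M. 3 * M * exp (- (sqrt M / (3 * fact k))) < \<delta>) at_top"
    using \<delta> by (rule order_tendstoD)
  then obtain M0 :: real where M0: "\<And>M. M \<ge> M0 \<Longrightarrow> 3 * M * exp (- (sqrt M / (3 * fact k))) < \<delta>"
    by (auto simp: eventually_at_top_linorder)
  define c where "c = max 1 (k * M0)"
  have subset: "\<exists>J\<subseteq>A. finite J \<and> card J = n" if "infinite A \<or> n \<le> card A" for A :: "'a set" and n
    using that infinite_arbitrarily_large[of A n] obtain_subset_with_card_n[of n A]
    by (metis)
  have "\<exists>J\<subseteq>A. finite J \<and> J \<noteq> {} \<and> card (small_fibre_maps J S k) / real (card S) ^ card J < \<delta>"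
    if S: "finite S" "S \<noteq> {}" and A: "infinite A \<or> c * real (card S) powr (1 - 1 / (2 * real k)) < real (card A)"
    for A :: "'a set" and S :: "'b set"
  proof -
    define M where "M = card S"
    have M: "M \<ge> 1" using S by (simp add: M_def Suc_le_eq card_gt_0_iff)
    define y where "y = real M powr (1 - 1 / (2 * real k))"
    have y1: "1 \<le> y" using M k by (auto simp: y_def intro!: ge_one_powr_ge_zero)
    have yM: "y \<le> M" using M k powr_mono[of "1 - 1 / (2 * real k)" 1 "real M"] by (simp add: y_def)
    show ?thesis
    proof (cases "real M < M0")
      case True
      have "infinite A \<or> k * M \<le> card A"
      proof (rule disjCI)
        assume "\<not> k * M \<le> card A"
        then have "real (card A) \<le> real k * real M" by (simp flip: of_nat_mult)
        also have "\<dots> \<le> k * M0" using True by (intro mult_left_mono) auto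
        also have "\<dots> \<le> c * 1" by (simp add: c_def)
        also have "\<dots> \<le> c * y" using y1 by (intro mult_left_mono) (auto simp: c_def)
        finally show "infinite A" using A by (simp add: y_def M_def)
      qed
      then obtain J where J: "J \<subseteq> A" "finite J" "card J = k * M" using subset by blast
      have "small_fibre_maps J S k = {}"
        using S J by (intro small_fibre_maps_empty) (auto simp: M_def)
      moreover have "J \<noteq> {}" using J M k by auto
      ultimately show ?thesis using J \<delta> by (intro exI[of _ J]) simp
    next
      case False
      define n where "n = nat \<lceil>y\<rceil>"
      have n: "y \<le> n" "1 \<le> n" "n \<le> M"
        using y1 yM by (auto simp: n_def le_nat_iff) (linarith+)?
      have "infinite A \<or> n \<le> card A"
      proof (rule disjCI)
        assume "\<not> n \<le> card A"
        then have "real (card A) \<le> y" unfolding n_def by linarith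
        also have "\<dots> \<le> c * y" using y1 by (simp add: c_def)
        finally show "infinite A" using A by (simp add: y_def M_def)
      qed
      then obtain J where J: "J \<subseteq> A" "finite J" "card J = n" using subset by blast
      have "card (small_fibre_maps J S k) / real M ^ card J
        \<le> 3 * real M * exp (- (real M * (real n / real M) ^ k / (3 * fact k)))"
        using small_fibre_fraction_le[of S J k] S J n by (simp add: M_def)
      also have "\<dots> \<le> 3 * real M * exp (- (sqrt (real M) / (3 * fact k)))"
      proof -
        have "sqrt (real M) = real M * (real M powr (- (1 / (2 * real k)))) ^ k"
        proof -
          have "(real M powr (- (1 / (2 * real k)))) ^ k = real M powr (- (1/2))"
            using M k by (simp add: powr_power)
          then show ?thesis using M
            by (simp add: powr_half_sqrt[symmetric] powr_mult_base)
        qed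
        also have "real M powr (- (1 / (2 * real k))) = y / M"
          using M by (simp add: y_def powr_diff powr_minus field_simps)
        also have "real M * (y / M) ^ k \<le> real M * (real n / real M) ^ k"
          using n y1 by (intro mult_left_mono power_mono divide_right_mono) auto
        finally have "sqrt (real M) / (3 * fact k) \<le> real M * (real n / real M) ^ k / (3 * fact k)"
          by (intro divide_right_mono) auto
        then show ?thesis by (intro mult_left_mono) auto
      qed
      also have "\<dots> < \<delta>" using M0 False by simp
      finally show ?thesis using J n by (intro exI[of _ J]) (auto simp: M_def)
    qed
  qed
  then show ?thesis by (intro exI[of _ c]) (auto simp: c_def)
qed

section \<open>Random points in dyadic cells\<close>

definition dyadic_cell :: "('d \<Rightarrow> nat) \<Rightarrow> ('d \<Rightarrow> nat) \<Rightarrow> (real ^ 'd) set"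
  where "dyadic_cell m b = {x. \<forall>i. x $ i \<in> {real (b i) / 2 ^ m i ..< (real (b i) + 1) / 2 ^ m i}}"

definition cell_indices :: "('d \<Rightarrow> nat) \<Rightarrow> ('d \<Rightarrow> nat) set"
  where "cell_indices m = (\<Pi>\<^sub>E i\<in>UNIV. {..<2 ^ m i})"

lemma finite_cell_indices [simp]: "finite (cell_indices (m :: 'd::finite \<Rightarrow> nat))"
  unfolding cell_indices_def by (intro finite_PiE) auto

lemma card_cell_indices: "card (cell_indices (m :: 'd::finite \<Rightarrow> nat)) = 2 ^ sum m UNIV"
  by (simp add: cell_indices_def card_PiE power_sum)

lemma dyadic_cell_borel: "dyadic_cell m b \<in> sets borel"
  unfolding dyadic_cell_def by (rule emeasure_lborel_product_set(2)) auto

lemma unit_cube_cell: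
  fixes x :: "real ^ 'd"
  assumes "x \<in> unit_cube"
  obtains b where "b \<in> cell_indices m" "x \<in> dyadic_cell m b"
proof
  let ?b = "\<lambda>i. nat \<lfloor>2 ^ m i * x $ i\<rfloor>"
  have x: "0 \<le> x $ i" "x $ i < 1" for i using assms by (auto simp: unit_cube_def)
  have b: "real (?b i) \<le> 2 ^ m i * x $ i" "2 ^ m i * x $ i < real (?b i) + 1" for i
    using x[of i] by auto
  show "?b \<in> cell_indices m"
    unfolding cell_indices_def
  proof (intro PiE_I)
    fix i
    have "real (?b i) \<le> 2 ^ m i * x $ i" by (rule b)
    also have "\<dots> < 2 ^ m i" using x by simp
    finally have "real (?b i) < 2 ^ m i" .
    then show "?b i \<in> {..<2 ^ m i}" by (metis lessThan_iff of_nat_less_iff of_nat_numeral of_nat_power)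
  qed auto
  show "x \<in> dyadic_cell m ?b"
    unfolding dyadic_cell_def
  proof (intro CollectI allI)
    fix i show "x $ i \<in> {real (?b i) / 2 ^ m i ..< (real (?b i) + 1) / 2 ^ m i}"
      unfolding atLeastLessThan_iff using b[of i]
      by (subst pos_divide_le_eq, simp, subst pos_less_divide_eq, simp) (simp add: mult.commute)
  qed
qed

context prob_space
begin

lemma prob_dyadic_cell:
  fixes X :: "'a \<Rightarrow> real ^ 'd"
  assumes X: "X \<in> borel_measurable M" and unif: "distr M borel X = uniform_measure lborel unit_cube"
    and b: "b \<in> cell_indices m"
  shows "prob (X -` dyadic_cell m b \<inter> space M) = 1 / real (card (cell_indices m))"
proof -
  have "emeasure M (X -` dyadic_cell m b \<inter> space M)
    = (\<Prod>i\<in>UNIV. emeasure lborel ({real (b i) / 2 ^ m i ..< (real (b i) + 1) / 2 ^ m i} \<inter> {0..<1}))"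
    unfolding dyadic_cell_def by (rule emeasure_uniform_cube[OF X unif]) auto
  also have "\<dots> = (\<Prod>i\<in>(UNIV :: 'd set). ennreal (1 / 2 ^ m i))"
  proof (intro prod.cong refl)
    fix i
    have "b i < 2 ^ m i" using b by (auto simp: cell_indices_def)
    then have "Suc (b i) \<le> 2 ^ m i" by simp
    then have "real (Suc (b i)) \<le> 2 ^ m i"
      by (metis of_nat_le_iff of_nat_numeral of_nat_power)
    then have "(real (b i) + 1) / 2 ^ m i \<le> 1" by simp
    then have "{real (b i) / 2 ^ m i ..< (real (b i) + 1) / 2 ^ m i} \<inter> {0..<1}
      = {real (b i) / 2 ^ m i ..< (real (b i) + 1) / 2 ^ m i}"
      by (auto intro: order.trans[rotated] simp: divide_nonneg_pos)
    then show "emeasure lborel ({real (b i) / 2 ^ m i ..< (real (b i) + 1) / 2 ^ m i} \<inter> {0..<1}) = ennreal (1 / 2 ^ m i)"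
      by (simp add: divide_right_mono flip: diff_divide_distrib)
  qed
  also have "\<dots> = ennreal (1 / real (card (cell_indices m)))"
    by (simp add: prod_ennreal card_cell_indices power_sum prod_dividef)
  finally show ?thesis by (simp add: measure_def)
qed

lemma AE_unit_cube:
  fixes X :: "'a \<Rightarrow> real ^ 'd"
  assumes X: "X \<in> borel_measurable M" and unif: "distr M borel X = uniform_measure lborel unit_cube"
  shows "AE \<omega> in M. X \<omega> \<in> unit_cube"
proof -
  have cube: "(unit_cube :: (real^'d) set) = {x. \<forall>i. x $ i \<in> {0..<1}}" by (auto simp: unit_cube_def)
  have "emeasure M (X -` unit_cube \<inter> space M) = (\<Prod>i\<in>(UNIV::'d set). emeasure lborel ({0..<1::real} \<inter> {0..<1}))"
    unfolding cube by (rule emeasure_uniform_cube[OF X unif]) auto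
  then have "prob (X -` unit_cube \<inter> space M) = 1" by (simp add: measure_def)
  moreover have "X -` unit_cube \<inter> space M \<in> events"
    using emeasure_lborel_product_set(2)[of "\<lambda>_::'d. {0..<1}"] by (intro measurable_sets[OF X]) (simp add: cube)
  ultimately have "AE \<omega> in M. \<omega> \<in> X -` unit_cube \<inter> space M" by (subst (asm) prob_eq_1)
  then show ?thesis by auto
qed

text \<open>The cells containing the points of \<open>J\<close> form a uniformly distributed random map from \<open>J\<close> into
  the set of cells. The event is given as a measurable subset \<open>A\<close>, to be applied to the event
  that a fixed embedding constant is valid.\<close>

lemma prob_no_crowded_cell_le:
  fixes X :: "nat \<Rightarrow> 'a \<Rightarrow> real ^ 'd"
  assumes ind: "indep_vars (\<lambda>n. borel) X UNIV"
    and unif: "\<And>n. distr M borel (X n) = uniform_measure lborel unit_cube"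
    and J: "finite J" "J \<noteq> {}"
    and A: "A \<subseteq> {\<omega> \<in> space M. \<forall>b\<in>cell_indices m. card {n\<in>J. X n \<omega> \<in> dyadic_cell m b} < k}" "A \<in> events"
  shows "prob A \<le> card (small_fibre_maps J (cell_indices m) k) / real (card (cell_indices m)) ^ card J"
proof -
  have X[measurable]: "X n \<in> borel_measurable M" for n
    using ind by (auto simp: indep_vars_def)
  let ?F = "small_fibre_maps J (cell_indices m) k"
  let ?B = "\<lambda>f. (\<Inter>n\<in>J. X n -` dyadic_cell m (f n) \<inter> space M)"
  have finF: "finite ?F" using J by (intro finite_small_fibre_maps) auto
  have B: "?B f \<in> events" for f
    using J by (intro sets.finite_INT measurable_sets[OF X dyadic_cell_borel]) auto
  have "AE \<omega> in M. \<forall>n\<in>J. X n \<omega> \<in> unit_cube"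
    using J AE_unit_cube[OF X unif] by (intro AE_finite_allI) auto
  then have "AE \<omega> in M. \<omega> \<in> A \<longrightarrow> \<omega> \<in> (\<Union>f\<in>?F. ?B f)"
  proof (rule AE_mp, intro AE_I2 impI)
    fix \<omega> assume cube: "\<forall>n\<in>J. X n \<omega> \<in> unit_cube" and w: "\<omega> \<in> A"
    have "\<exists>b. b \<in> cell_indices m \<and> X n \<omega> \<in> dyadic_cell m b" if "n \<in> J" for n
      using unit_cube_cell[of "X n \<omega>" m] cube that by blast
    then obtain g where g: "\<And>n. n \<in> J \<Longrightarrow> g n \<in> cell_indices m \<and> X n \<omega> \<in> dyadic_cell m (g n)" by metis
    have "card {n\<in>J. restrict g J n = b} < k" if "b \<in> cell_indices m" for b
    proof -
      have "card {n\<in>J. restrict g J n = b} \<le> card {n\<in>J. X n \<omega> \<in> dyadic_cell m b}"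
        using J g by (intro card_mono) auto
      also have "\<dots> < k" using A w that by auto
      finally show ?thesis .
    qed
    then have "restrict g J \<in> ?F" using g by (auto simp: small_fibre_maps_def simp del: restrict_apply)
    moreover have "\<omega> \<in> ?B (restrict g J)" using g w A by auto
    ultimately show "\<omega> \<in> (\<Union>f\<in>?F. ?B f)" by blast
  qed
  then have "prob A \<le> prob (\<Union>f\<in>?F. ?B f)"
    by (rule finite_measure_mono_AE) (intro sets.finite_UN finF B)
  also have "\<dots> \<le> (\<Sum>f\<in>?F. prob (?B f))"
    by (intro finite_measure_subadditive_finite finF image_subsetI B)
  also have "\<dots> = (\<Sum>f\<in>?F. (1 / real (card (cell_indices m))) ^ card J)"
  proof (intro sum.cong refl)
    fix f assume f: "f \<in> ?F"
    have "prob (?B f) = (\<Prod>n\<in>J. prob (X n -` dyadic_cell m (f n) \<inter> space M))"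
      using J by (intro indep_varsD[OF ind]) (auto simp: dyadic_cell_borel)
    also have "\<dots> = (\<Prod>n\<in>J. 1 / real (card (cell_indices m)))"
      using f by (intro prod.cong refl prob_dyadic_cell[OF X unif]) (auto simp: small_fibre_maps_def)
    finally show "prob (?B f) = (1 / real (card (cell_indices m))) ^ card J" by simp
  qed
  finally show ?thesis by (simp add: power_divide)
qed

end

section \<open>A Carleson sequence is sparse in every dyadic cell\<close>

text \<open>Each of \<open>1 - \<bar>z\<bar>\<^sup>2\<close> and \<open>1 - \<bar>w\<bar>\<^sup>2\<close> is at least \<open>h / 2\<close> for \<open>h = 1 / 2 ^ m\<close>, and
  \<open>\<bar>1 - cnj w * z\<bar>\<close> is at most \<open>2 * h + 7 * h\<close>; and \<open>324 = (2 * 9)\<^sup>2\<close>.\<close>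

lemma normalized_kernel_ge:
  fixes z w :: complex
  assumes z: "z \<noteq> 0" "1 / 2 ^ (m + 1) \<le> 1 - cmod z" "1 - cmod z \<le> 1 / 2 ^ m"
    and w: "w \<noteq> 0" "1 / 2 ^ (m + 1) \<le> 1 - cmod w" "1 - cmod w \<le> 1 / 2 ^ m"
    and near: "cmod (sgn z - sgn w) \<le> 7 / 2 ^ m"
  shows "1 / 324 \<le> (1 - (cmod z)\<^sup>2) * (1 - (cmod w)\<^sup>2) * (cmod (1 / (1 - cnj w * z)))\<^sup>2"
proof -
  define h where "h = 1 / (2::real) ^ m"
  have h: "h > 0" by (simp add: h_def)
  have zh: "h / 2 \<le> 1 - cmod z" "1 - cmod z \<le> h" and wh: "h / 2 \<le> 1 - cmod w" "1 - cmod w \<le> h"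
    using z w by (auto simp: h_def)
  have lt: "cmod z < 1" "cmod w < 1" using zh wh h by linarith+
  have sq: "h / 2 \<le> 1 - (cmod u)\<^sup>2" if "h / 2 \<le> 1 - cmod u" "cmod u < 1" for u :: complex
  proof -
    have "(cmod u)\<^sup>2 \<le> cmod u" using that by (simp add: power2_eq_square mult_left_le_one_le)
    then show ?thesis using that by linarith
  qed
  define \<rho> where "\<rho> = cmod z * cmod w"
  have rho: "0 \<le> \<rho>" "\<rho> \<le> 1" using lt by (auto simp: \<rho>_def mult_le_one)
  have "1 - \<rho> = (1 - cmod z) + cmod z * (1 - cmod w)" by (simp add: \<rho>_def algebra_simps)
  also have "\<dots> \<le> h + 1 * h" using zh wh lt h by (intro add_mono mult_mono) auto
  finally have r: "1 - \<rho> \<le> 2 * h" by simp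
  have e: "cnj w * z = of_real \<rho> * (cnj (sgn w) * sgn z)"
    using z w by (simp add: \<rho>_def sgn_div_norm scaleR_conv_of_real field_simps)
  have "1 - cnj w * z = of_real (1 - \<rho>) + of_real \<rho> * (1 - cnj (sgn w) * sgn z)"
    unfolding e by (simp add: algebra_simps)
  then have "cmod (1 - cnj w * z) \<le> cmod (of_real (1 - \<rho>)) + cmod (of_real \<rho> * (1 - cnj (sgn w) * sgn z))"
    by (metis norm_triangle_ineq)
  also have "\<dots> = (1 - \<rho>) + \<rho> * cmod (sgn z - sgn w)"
    using rho norm_sgn_diff[OF z(1) w(1)] by (simp add: norm_mult del: of_real_diff)
  also have "\<dots> \<le> 2 * h + 1 * (7 * h)"
    using r rho near by (intro add_mono mult_mono) (auto simp: h_def)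
  finally have d: "cmod (1 - cnj w * z) \<le> 9 * h" by simp
  have pos: "0 < cmod (1 - cnj w * z)"
    using one_minus_norm_le_norm_one_minus_cnj_mult[of w z] lt by linarith
  have "1 / (9 * h) \<le> cmod (1 / (1 - cnj w * z))"
    using d pos h by (simp add: norm_divide frac_le)
  then have p1: "(1 / (9 * h))\<^sup>2 \<le> (cmod (1 / (1 - cnj w * z)))\<^sup>2"
    using h by (intro power_mono) auto
  have p2: "(h / 2) * (h / 2) \<le> (1 - (cmod z)\<^sup>2) * (1 - (cmod w)\<^sup>2)"
    using sq[OF zh(1) lt(1)] sq[OF wh(1) lt(2)] h by (intro mult_mono) auto
  have "(h / 2) * (h / 2) * (1 / (9 * h))\<^sup>2
      \<le> (1 - (cmod z)\<^sup>2) * (1 - (cmod w)\<^sup>2) * (cmod (1 / (1 - cnj w * z)))\<^sup>2"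
    using lt by (intro mult_mono[OF p2 p1]) (auto simp: abs_square_le_1)
  moreover have "(h / 2) * (h / 2) * (1 / (9 * h))\<^sup>2 = 1 / 324"
    using h by (simp add: power2_eq_square)
  ultimately show ?thesis by simp
qed

text \<open>The embedding inequality is tested on the kernel function of the point \<open>z p\<close>: every point in the
  same cell contributes at least a fixed proportion of the squared norm of this function.\<close>

lemma (in hardy_space) card_cell_le_if_embedding:
  fixes z :: "nat \<Rightarrow> complex ^ 'd" and C :: real
  assumes emb: "\<And>N f. f \<in> H \<Longrightarrow> (\<Sum>n<N. kernel_weight (z n) * (cmod (f (z n)))\<^sup>2) \<le> C * (ip_norm ip f)\<^sup>2"
    and T: "finite T" "p \<in> T"
    and nz: "\<And>n i. z n $ i \<noteq> 0"
    and zp: "\<And>n. z n \<in> polydisc"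
    and lev: "\<And>n i. n \<in> T \<Longrightarrow> 1 / 2 ^ (m i + 1) \<le> 1 - cmod (z n $ i) \<and> 1 - cmod (z n $ i) \<le> 1 / 2 ^ m i"
    and near: "\<And>n i. n \<in> T \<Longrightarrow> cmod (sgn (z n $ i) - sgn (z p $ i)) \<le> 7 / 2 ^ m i"
  shows "real (card T) \<le> C * 324 ^ CARD('d)"
proof -
  define g where "g = kernel_fun polydisc szego (z p)"
  have g: "g \<in> H" using kernel_mem zp by (simp add: g_def)
  have wpos: "kernel_weight (z p) > 0"
    using zp[of p] by (auto simp: kernel_weight_def polydisc_def abs_square_less_1 intro!: prod_pos)
  have "1 / (ip_norm ip g)\<^sup>2 = kernel_weight (z p)"
    using kernel_norm_sq[OF zp[of p]] by (simp add: g_def kernel_weight_def)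
  then have gn: "(ip_norm ip g)\<^sup>2 = 1 / kernel_weight (z p)"
    by (metis divide_divide_eq_right div_by_1 mult_1)
  obtain N where N: "T \<subseteq> {..<N}" using T finite_nat_set_iff_bounded by auto
  have "real (card T) * (1 / 324) ^ CARD('d) = (\<Sum>n\<in>T. \<Prod>i\<in>(UNIV :: 'd set). 1 / 324)" by simp
  also have "\<dots> \<le> (\<Sum>n\<in>T. \<Prod>i\<in>UNIV. (1 - (cmod (z n $ i))\<^sup>2) * (1 - (cmod (z p $ i))\<^sup>2) * (cmod (1 / (1 - cnj (z p $ i) * z n $ i)))\<^sup>2)"
  proof (intro sum_mono prod_mono conjI)
    fix n and i :: 'd assume n: "n \<in> T"
    show "1 / 324 \<le> (1 - (cmod (z n $ i))\<^sup>2) * (1 - (cmod (z p $ i))\<^sup>2) * (cmod (1 / (1 - cnj (z p $ i) * z n $ i)))\<^sup>2"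
      using lev[OF n] lev[OF T(2)] near[OF n] nz by (intro normalized_kernel_ge[where m = "m i"]) auto
  qed auto
  also have "\<dots> = (\<Sum>n\<in>T. kernel_weight (z p) * (kernel_weight (z n) * (cmod (g (z n)))\<^sup>2))"
  proof (intro sum.cong refl)
    fix n
    have "(cmod (g (z n)))\<^sup>2 = (\<Prod>i\<in>UNIV. (cmod (1 / (1 - cnj (z p $ i) * z n $ i)))\<^sup>2)"
      using zp[of n] by (simp add: g_def kernel_fun_def szego_def prod_power_distrib flip: prod_norm)
    then show "(\<Prod>i\<in>UNIV. (1 - (cmod (z n $ i))\<^sup>2) * (1 - (cmod (z p $ i))\<^sup>2) * (cmod (1 / (1 - cnj (z p $ i) * z n $ i)))\<^sup>2)
      = kernel_weight (z p) * (kernel_weight (z n) * (cmod (g (z n)))\<^sup>2)"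
      unfolding prod.distrib kernel_weight_def by (simp only: mult_ac)
  qed
  also have "\<dots> \<le> (\<Sum>n<N. kernel_weight (z p) * (kernel_weight (z n) * (cmod (g (z n)))\<^sup>2))"
    using N wpos kernel_weight_nonneg[OF zp] by (intro sum_mono2) auto
  also have "\<dots> = kernel_weight (z p) * (\<Sum>n<N. kernel_weight (z n) * (cmod (g (z n)))\<^sup>2)"
    by (simp add: sum_distrib_left)
  also have "\<dots> \<le> kernel_weight (z p) * (C * (1 / kernel_weight (z p)))"
    using emb[OF g, of N] wpos by (intro mult_left_mono) (auto simp: gn)
  also have "\<dots> = C" using wpos by simp
  finally show ?thesis by (simp add: power_divide field_simps)
qed

section \<open>The Carleson event and the radii\<close>

definition torus_point :: "real ^ 'd \<Rightarrow> real ^ 'd \<Rightarrow> complex ^ 'd"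
  where "torus_point \<rho> t = (\<chi> i. complex_of_real (\<rho> $ i) * circle_exp (t $ i))"

lemma random_seq_eq_torus_point: "random_seq r \<theta> \<omega> n = torus_point (r n) (\<theta> n \<omega>)"
  by (simp add: random_seq_def torus_point_def circle_exp_def)

lemma torus_point_nth:
  assumes "0 < \<rho> $ i"
  shows "cmod (torus_point \<rho> t $ i) = \<rho> $ i" "sgn (torus_point \<rho> t $ i) = circle_exp (t $ i)"
    "torus_point \<rho> t $ i \<noteq> 0"
proof -
  have "circle_exp (t $ i) \<noteq> 0" by (simp add: circle_exp_def)
  then show "torus_point \<rho> t $ i \<noteq> 0" using assms by (simp add: torus_point_def)
  show "cmod (torus_point \<rho> t $ i) = \<rho> $ i" using assms by (simp add: torus_point_def norm_mult)
  show "sgn (torus_point \<rho> t $ i) = circle_exp (t $ i)"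
    using assms by (simp add: torus_point_def sgn_div_norm norm_mult scaleR_conv_of_real)
qed

lemma continuous_on_torus_point: "continuous_on S (torus_point \<rho>)"
  unfolding torus_point_def circle_exp_def by (intro continuous_intros)

text \<open>For fixed radii the weights are constant, and every element of \<open>H\<close> is continuous on the polydisc.
  The intersection over the uncountably many \<open>f\<close> is therefore closed, and hence measurable.\<close>

lemma (in hardy_space) closed_embedding_angles:
  assumes r: "\<And>n i. 0 < r n $ i \<and> r n $ i < 1"
  shows "closed {x :: nat \<Rightarrow> real ^ 'd. \<forall>N. \<forall>f\<in>H.
    (\<Sum>n<N. kernel_weight (torus_point (r n) (x n)) * (cmod (f (torus_point (r n) (x n))))\<^sup>2) \<le> C * (ip_norm ip f)\<^sup>2}"
proof -
  have zp: "torus_point (r n) t \<in> polydisc" for n t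
    using r by (simp add: polydisc_def torus_point_nth)
  have cont: "continuous_on UNIV (\<lambda>x :: nat \<Rightarrow> real ^ 'd. torus_point (r n) (x n))" for n
    by (intro continuous_on_compose2[OF continuous_on_torus_point[of UNIV]] continuous_on_product_coordinates) auto
  have w: "kernel_weight (torus_point (r n) t) = (\<Prod>i\<in>UNIV. 1 - (r n $ i)\<^sup>2)" for n t
    using r by (simp add: kernel_weight_def torus_point_nth)
  let ?L = "\<lambda>N f x. \<Sum>n<N. kernel_weight (torus_point (r n) (x n)) * (cmod (f (torus_point (r n) (x n))))\<^sup>2"
  have "closed {x :: nat \<Rightarrow> real ^ 'd. ?L N f x \<le> C * (ip_norm ip f)\<^sup>2}" if "f \<in> H" for N f
    unfolding w
    using continuous_on_compose2[OF continuous_on_polydisc[OF that] cont] zp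
    by (intro closed_Collect_le continuous_intros) auto
  then have "closed (\<Inter>N. \<Inter>f\<in>H. {x :: nat \<Rightarrow> real ^ 'd. ?L N f x \<le> C * (ip_norm ip f)\<^sup>2})"
    by (intro closed_INT ballI) auto
  also have "(\<Inter>N. \<Inter>f\<in>H. {x :: nat \<Rightarrow> real ^ 'd. ?L N f x \<le> C * (ip_norm ip f)\<^sup>2})
    = {x. \<forall>N. \<forall>f\<in>H. ?L N f x \<le> C * (ip_norm ip f)\<^sup>2}" by auto
  finally show ?thesis .
qed

lemma exists_dyadic_level:
  fixes h :: real
  assumes "0 < h" "h < 1"
  shows "\<exists>l. 1 / 2 ^ (l + 1) \<le> h \<and> h < 1 / 2 ^ l"
proof -
  obtain n where "(1 / 2) ^ n < h" using real_arch_pow_inv[of h "1/2"] assms by auto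
  moreover have "1 / 2 ^ (n + 1) \<le> (1 / 2 :: real) ^ n" by (simp add: power_divide field_simps)
  ultimately have ex: "1 / 2 ^ (n + 1) \<le> h" by linarith
  define l where "l = (LEAST l. 1 / 2 ^ (l + 1) \<le> h)"
  have l: "1 / 2 ^ (l + 1) \<le> h" unfolding l_def using ex by (rule LeastI)
  have "h < 1 / 2 ^ l"
  proof (cases l)
    case 0
    then show ?thesis using assms by simp
  next
    case (Suc j)
    then have "\<not> 1 / 2 ^ (j + 1) \<le> h" using not_less_Least[of j "\<lambda>l. 1 / 2 ^ (l + 1) \<le> h"] by (simp add: l_def)
    then show ?thesis using Suc by simp
  qed
  with l show ?thesis by blast
qed

lemma dyadic_level_unique:
  fixes h :: real
  assumes "1 / 2 ^ (l + 1) \<le> h" "h < 1 / 2 ^ l" "1 / 2 ^ (m + 1) \<le> h" "h < 1 / 2 ^ m"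
  shows "l = m"
proof -
  have *: "i \<le> j" if "1 / 2 ^ (j + 1) \<le> h" "h < 1 / 2 ^ i" for i j
  proof -
    have "1 / 2 ^ (j + 1) < 1 / (2 :: real) ^ i" using that by linarith
    then have "(2 :: real) ^ i < 2 ^ (j + 1)" by (simp add: field_simps)
    then have "i < j + 1" by (subst (asm) power_strict_increasing_iff) auto
    then show ?thesis by simp
  qed
  show ?thesis using *[of l m] *[of m l] assms by (intro antisym)
qed

lemma ennreal_of_enat_index_count_le_iff:
  assumes "0 \<le> c"
  shows "ennreal_of_enat (index_count z m) \<le> ennreal c \<longleftrightarrow>
    finite {n. z n \<in> dyadic_annulus m} \<and> real (card {n. z n \<in> dyadic_annulus m}) \<le> c"
  using assms by (simp add: index_count_def Let_def ennreal_of_nat_eq_real_of_nat top_unique)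

theorem theorem1p1:
  fixes M :: "'w measure"
    and r :: "nat \<Rightarrow> real ^ 'd"
    and \<theta> :: "nat \<Rightarrow> 'w \<Rightarrow> real ^ 'd"
    and N :: "nat ^ 'd \<Rightarrow> enat"
    and H :: "(complex ^ 'd \<Rightarrow> complex) set"
    and ip :: "(complex ^ 'd \<Rightarrow> complex) \<Rightarrow> (complex ^ 'd \<Rightarrow> complex) \<Rightarrow> complex"
  assumes "hardy_space H ip"
    and "prob_space M"
    and "\<And>n i. 0 < r n $ i \<and> r n $ i < 1"
    and "prob_space.indep_vars M (\<lambda>n. borel) \<theta> UNIV"
    and "\<And>n. distr M borel (\<theta> n) = uniform_measure lborel unit_cube"
    and "\<And>\<omega> m. \<omega> \<in> space M \<Longrightarrow> N m = index_count (random_seq r \<theta> \<omega>) m"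
  shows "let growth = (\<exists>\<epsilon>>0. \<exists>C>0. \<forall>m. ennreal_of_enat (N m)
                        \<le> ennreal (C * 2 powr ((1 - \<epsilon>) * real (multi_abs m))));
             E = {\<omega> \<in> space M. carleson_sequence H ip (random_seq r \<theta> \<omega>)}
         in E \<in> sets M \<and>
            (growth \<longrightarrow> measure M E = 1) \<and>
            (\<not> growth \<longrightarrow> measure M E = 0)"
proof -
  interpret hardy_space H ip by fact
  interpret prob_space M by fact
  note r = assms(3) and ind = assms(4) and unif = assms(5)
  have X[measurable]: "\<theta> n \<in> borel_measurable M" for n
    using ind by (auto simp: indep_vars_def)
  let ?z = "random_seq r \<theta>"
  have z_abs: "cmod (?z \<omega> n $ i) = r n $ i" and z_sgn: "sgn (?z \<omega> n $ i) = circle_exp (\<theta> n \<omega> $ i)"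
    and z_nz: "?z \<omega> n $ i \<noteq> 0" for \<omega> n i
    using r by (simp_all add: random_seq_eq_torus_point torus_point_nth)
  have zp: "?z \<omega> n \<in> polydisc" for \<omega> n using r by (simp add: polydisc_def z_abs)

  have "\<forall>n i. \<exists>l. 1 / 2 ^ (l + 1) \<le> 1 - r n $ i \<and> 1 - r n $ i < 1 / 2 ^ l"
    by (intro allI exists_dyadic_level) (simp_all add: r)
  then obtain lev where lev: "\<And>n i. 1 / 2 ^ (lev n i + 1) \<le> 1 - r n $ i \<and> 1 - r n $ i < 1 / 2 ^ lev n i"
    by metis
  have annulus: "{n. ?z \<omega> n \<in> dyadic_annulus m} = {n. lev n = (\<lambda>i. m $ i)}" for \<omega> m
  proof (intro Collect_cong iffI)
    fix n assume "?z \<omega> n \<in> dyadic_annulus m"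
    then have "1 / 2 ^ (m $ i + 1) \<le> 1 - r n $ i \<and> 1 - r n $ i < 1 / 2 ^ (m $ i)" for i
      by (simp add: dyadic_annulus_def z_abs)
    then show "lev n = (\<lambda>i. m $ i)"
      by (intro ext dyadic_level_unique[of "lev n _" "1 - r n $ _"]) (use lev in auto)
  next
    fix n assume "lev n = (\<lambda>i. m $ i)"
    then have "lev n i = m $ i" for i by (rule fun_cong)
    then show "?z \<omega> n \<in> dyadic_annulus m"
      using lev[of n] zp[of \<omega> n] by (simp add: dyadic_annulus_def z_abs)
  qed
  obtain \<omega>0 where \<omega>0: "\<omega>0 \<in> space M" using not_empty by blast
  define growth where "growth = (\<exists>\<epsilon>>0. \<exists>C>0. \<forall>m. ennreal_of_enat (N m)
                        \<le> ennreal (C * 2 powr ((1 - \<epsilon>) * real (multi_abs m))))"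
  have growth_iff: "growth \<longleftrightarrow> (\<exists>\<epsilon>>0. \<exists>C>0. \<forall>l. finite {n. lev n = l}
      \<and> real (card {n. lev n = l}) \<le> C * 2 powr ((1 - \<epsilon>) * real (sum l UNIV)))"
  proof -
    have eq: "(ennreal_of_enat (N m) \<le> ennreal (C * 2 powr ((1 - \<epsilon>) * real (multi_abs m)))) \<longleftrightarrow>
      finite {n. lev n = (\<lambda>i. m $ i)} \<and> real (card {n. lev n = (\<lambda>i. m $ i)})
        \<le> C * 2 powr ((1 - \<epsilon>) * real (sum (\<lambda>i. m $ i) UNIV))" if "C > 0" for C \<epsilon> :: real and m :: "nat ^ 'd"
      unfolding assms(6)[OF \<omega>0] using that
      by (subst ennreal_of_enat_index_count_le_iff) (simp_all add: annulus multi_abs_def)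
    have all: "(\<forall>m :: nat ^ 'd. P (\<lambda>i. m $ i)) \<longleftrightarrow> (\<forall>l. P l)" for P
    proof
      assume *: "\<forall>m :: nat ^ 'd. P (\<lambda>i. m $ i)"
      show "\<forall>l. P l"
      proof
        fix l :: "'d \<Rightarrow> nat"
        have "($) (\<chi> i. l i) = l" by (rule ext) simp
        then show "P l" using *[rule_format, of "\<chi> i. l i"] by metis
      qed
    qed simp
    show ?thesis
      unfolding growth_def
    proof (intro ex_cong1 conj_cong refl)
      fix \<epsilon> C :: real assume "C > 0"
      show "(\<forall>m. ennreal_of_enat (N m) \<le> ennreal (C * 2 powr ((1 - \<epsilon>) * real (multi_abs m)))) \<longleftrightarrow>
        (\<forall>l. finite {n. lev n = l} \<and> real (card {n. lev n = l}) \<le> C * 2 powr ((1 - \<epsilon>) * real (sum l UNIV)))"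
        unfolding eq[OF \<open>C > 0\<close>] by (rule all)
    qed
  qed

  define bounded where "bounded C = {\<omega> \<in> space M. \<forall>N. \<forall>f\<in>H.
      (\<Sum>n<N. kernel_weight (?z \<omega> n) * (cmod (f (?z \<omega> n)))\<^sup>2) \<le> real C * (ip_norm ip f)\<^sup>2}" for C :: nat
  define E where "E = {\<omega> \<in> space M. carleson_sequence H ip (?z \<omega>)}"
  have E_eq: "E = (\<Union>C. bounded C)"
    using carleson_sequence_iff[of "?z _"] zp by (auto simp: E_def bounded_def)
  have bounded_meas: "bounded C \<in> events" for C
  proof -
    let ?K = "{x :: nat \<Rightarrow> real ^ 'd. \<forall>N. \<forall>f\<in>H.
      (\<Sum>n<N. kernel_weight (torus_point (r n) (x n)) * (cmod (f (torus_point (r n) (x n))))\<^sup>2) \<le> real C * (ip_norm ip f)\<^sup>2}"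
    have "(\<lambda>\<omega> n. \<theta> n \<omega>) \<in> borel_measurable M"
      by (rule measurable_coordinatewise_then_product) (rule X)
    moreover have "?K \<in> sets borel" by (rule borel_closed[OF closed_embedding_angles[OF r]])
    ultimately have "(\<lambda>\<omega> n. \<theta> n \<omega>) -` ?K \<inter> space M \<in> events" by (rule measurable_sets)
    also have "(\<lambda>\<omega> n. \<theta> n \<omega>) -` ?K \<inter> space M = bounded C"
      by (auto simp: bounded_def random_seq_eq_torus_point)
    finally show ?thesis .
  qed
  have E_meas: "E \<in> events" unfolding E_eq using bounded_meas by blast

  have "prob E = 1" if g: growth
  proof -
    obtain \<epsilon>0 C where e0: "\<epsilon>0 > 0" and C: "C > 0" and fin: "\<And>l. finite {n. lev n = l}"
      and card0: "\<And>l. real (card {n. lev n = l}) \<le> C * 2 powr ((1 - \<epsilon>0) * real (sum l UNIV))"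
      using g unfolding growth_iff by blast
    define \<epsilon> where "\<epsilon> = min \<epsilon>0 1"
    \<comment> \<open>So \<open>a ^ 4 = 2 powr (- \<epsilon>)\<close>, as the bound on the counts requires; \<open>\<epsilon> \<le> 1\<close> ensures \<open>a > 1 / 2\<close>.\<close>
    define a where "a = (2::real) powr (- \<epsilon> / 4)"
    have e: "0 < \<epsilon>" "\<epsilon> \<le> 1" using e0 by (auto simp: \<epsilon>_def)
    have a: "1/2 < a" "a < 1"
    proof -
      have "(2::real) powr (-1) < a" unfolding a_def using e by (intro powr_less_mono) auto
      then show "1/2 < a" by (simp add: powr_minus)
      have "a < 2 powr 0" unfolding a_def using e by (intro powr_less_mono) auto
      then show "a < 1" by simp
    qed
    have a4: "2 * a ^ 4 = 2 powr (1 - \<epsilon>)"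
    proof -
      have "a ^ 4 = a powr 4" using a by simp
      also have "\<dots> = 2 powr (- \<epsilon>)" unfolding a_def powr_powr by simp
      also have "2 * \<dots> = 2 powr (1 + - \<epsilon>)" unfolding powr_add by simp
      finally show ?thesis by simp
    qed
    have "(\<Prod>i\<in>UNIV. (2 * a ^ 4) ^ l i) = 2 powr ((1 - \<epsilon>) * real (sum l UNIV))" for l :: "'d \<Rightarrow> nat"
    proof -
      have "(\<Prod>i\<in>UNIV. (2 * a ^ 4) ^ l i) = (2 powr (1 - \<epsilon>)) ^ sum l UNIV"
        unfolding a4 power_sum ..
      also have "\<dots> = (2 powr (1 - \<epsilon>)) powr real (sum l UNIV)"
        by (rule powr_realpow[symmetric]) simp
      finally show ?thesis by (simp only: powr_powr)
    qed
    moreover have "C * 2 powr ((1 - \<epsilon>0) * real (sum l UNIV)) \<le> C * 2 powr ((1 - \<epsilon>) * real (sum l UNIV))" for l :: "'d \<Rightarrow> nat"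
      using C by (intro mult_left_mono powr_mono mult_right_mono) (auto simp: \<epsilon>_def intro: sum_nonneg)
    ultimately have sparse: "real (card {n. lev n = l}) \<le> C * (\<Prod>i\<in>UNIV. (2 * a ^ 4) ^ l i)" for l
      using order_trans[OF card0] by simp
    have "AE \<omega> in M. \<exists>K>0. \<forall>p l k. (\<forall>i. k i \<le> l i) \<longrightarrow>
      real (card {q. lev q = l \<and> (\<forall>i. cmod (circle_exp (\<theta> q \<omega> $ i) - circle_exp (\<theta> p \<omega> $ i)) \<le> 2 / 2 ^ k i)})
      \<le> K * (1 + (\<Prod>i\<in>UNIV. (2 * a\<^sup>2) ^ l i / 2 ^ k i))"
      using a C by (intro AE_count_near_le[OF ind unif _ _ _ fin sparse]) auto
    then have "AE \<omega> in M. \<omega> \<in> E"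
    proof (rule AE_mp, intro AE_I2 impI)
      fix \<omega> assume w: "\<omega> \<in> space M" and "\<exists>K>0. \<forall>p l k. (\<forall>i. k i \<le> l i) \<longrightarrow>
        real (card {q. lev q = l \<and> (\<forall>i. cmod (circle_exp (\<theta> q \<omega> $ i) - circle_exp (\<theta> p \<omega> $ i)) \<le> 2 / 2 ^ k i)})
        \<le> K * (1 + (\<Prod>i\<in>UNIV. (2 * a\<^sup>2) ^ l i / 2 ^ k i))"
      then obtain K where K: "K > 0" and count: "\<And>p l k. (\<And>i. k i \<le> l i) \<Longrightarrow>
        real (card {q. lev q = l \<and> (\<forall>i. cmod (circle_exp (\<theta> q \<omega> $ i) - circle_exp (\<theta> p \<omega> $ i)) \<le> 2 / 2 ^ k i)})
        \<le> K * (1 + (\<Prod>i\<in>UNIV. (2 * a\<^sup>2) ^ l i / 2 ^ k i))" by blast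
      have "carleson_sequence H ip (?z \<omega>)"
      proof (rule carleson_sequence_if_sparse[OF a K z_nz _ fin])
        show "1 / 2 ^ (lev n i + 1) \<le> 1 - cmod (?z \<omega> n $ i) \<and> 1 - cmod (?z \<omega> n $ i) \<le> 1 / 2 ^ lev n i" for n i
          using lev[of n i] by (simp add: z_abs)
      qed (use count in \<open>simp add: z_sgn\<close>)
      then show "\<omega> \<in> E" using w by (simp add: E_def)
    qed
    then show ?thesis using E_meas by (simp add: prob_eq_1)
  qed
  moreover have "prob E = 0" if "\<not> growth"
  proof -
    have "prob (bounded C) = 0" for C
    proof (rule ccontr)
      assume "prob (bounded C) \<noteq> 0"
      then have pos: "prob (bounded C) > 0" by (simp add: zero_less_measure_iff)
      \<comment> \<open>A cell with this many points of its own level contradicts the embedding constant \<open>C\<close>.\<close>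
      define k where "k = C * 324 ^ CARD('d) + 1"
      have "k \<ge> 1" by (simp add: k_def)
      obtain c where c: "c > 0" and few: "\<And>A (S :: ('d \<Rightarrow> nat) set). finite S \<Longrightarrow> S \<noteq> {} \<Longrightarrow>
        infinite A \<or> c * real (card S) powr (1 - 1 / (2 * real k)) < real (card A) \<Longrightarrow>
        \<exists>J\<subseteq>A. finite J \<and> J \<noteq> {} \<and> card (small_fibre_maps (J :: nat set) S k) / real (card S) ^ card J < prob (bounded C)"
        using exists_subset_few_small_fibre_maps[OF \<open>k \<ge> 1\<close> pos, where ?'a = nat and ?'b = "'d \<Rightarrow> nat"] by blast
      have "1 / (2 * real k) > 0" using \<open>k \<ge> 1\<close> by simp
      then obtain l where l: "infinite {n. lev n = l} \<or>
          c * 2 powr ((1 - 1 / (2 * real k)) * real (sum l UNIV)) < real (card {n. lev n = l})"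
        using \<open>\<not> growth\<close> c unfolding growth_iff by (metis not_le_imp_less)
      have "2 powr ((1 - 1 / (2 * real k)) * real (sum l UNIV)) = real (card (cell_indices l)) powr (1 - 1 / (2 * real k))"
        by (simp add: card_cell_indices powr_powr mult.commute flip: powr_realpow)
      then have big: "infinite {n. lev n = l} \<or>
          c * real (card (cell_indices l)) powr (1 - 1 / (2 * real k)) < real (card {n. lev n = l})"
        using l by metis
      have "cell_indices l \<noteq> {}" using card_cell_indices[of l] by (metis card.empty power_not_zero zero_neq_numeral)
      then obtain J where J: "J \<subseteq> {n. lev n = l}" "finite J" "J \<noteq> {}"
        "card (small_fibre_maps J (cell_indices l) k) / real (card (cell_indices l)) ^ card J < prob (bounded C)"
        using few[OF finite_cell_indices _ big] by blast
      have "bounded C \<subseteq> {\<omega> \<in> space M. \<forall>b\<in>cell_indices l. card {n\<in>J. \<theta> n \<omega> \<in> dyadic_cell l b} < k}"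
      proof (intro subsetI CollectI conjI ballI)
        fix \<omega> b assume w: "\<omega> \<in> bounded C"
        let ?T = "{n\<in>J. \<theta> n \<omega> \<in> dyadic_cell l b}"
        show "card ?T < k"
        proof (cases "?T = {}")
          case True
          then show ?thesis by (simp only: card.empty) (simp add: k_def)
        next
          case False
          then obtain p where p: "p \<in> ?T" by blast
          have "real (card ?T) \<le> real C * 324 ^ CARD('d)"
          proof (rule card_cell_le_if_embedding[where z = "?z \<omega>" and p = p and m = l])
            show "(\<Sum>n<N. kernel_weight (?z \<omega> n) * (cmod (f (?z \<omega> n)))\<^sup>2) \<le> real C * (ip_norm ip f)\<^sup>2" if "f \<in> H" for N f
              using w that by (simp add: bounded_def)
            show "1 / 2 ^ (l i + 1) \<le> 1 - cmod (?z \<omega> n $ i) \<and> 1 - cmod (?z \<omega> n $ i) \<le> 1 / 2 ^ l i" if "n \<in> ?T" for n i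
              using lev[of n i] that J(1) by (auto simp: z_abs)
            show "cmod (sgn (?z \<omega> n $ i) - sgn (?z \<omega> p $ i)) \<le> 7 / 2 ^ l i" if "n \<in> ?T" for n i
            proof -
              have "\<theta> n \<omega> $ i \<in> {real (b i) / 2 ^ l i ..< (real (b i) + 1) / 2 ^ l i}"
                "\<theta> p \<omega> $ i \<in> {real (b i) / 2 ^ l i ..< (real (b i) + 1) / 2 ^ l i}"
                using that p by (auto simp: dyadic_cell_def)
              then have "\<bar>\<theta> n \<omega> $ i - \<theta> p \<omega> $ i\<bar> \<le> 1 / 2 ^ l i"
                by (auto simp: abs_le_iff add_divide_distrib)
              then show ?thesis
                using norm_circle_exp_diff_le[of "\<theta> n \<omega> $ i" "\<theta> p \<omega> $ i"] by (simp add: z_sgn)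
            qed
          qed (use J p z_nz zp in auto)
          then have "real (card ?T) \<le> real (C * 324 ^ CARD('d))" by simp
          then show ?thesis unfolding k_def of_nat_le_iff by simp
        qed
      qed (simp add: bounded_def)
      then have "prob (bounded C) \<le> card (small_fibre_maps J (cell_indices l) k) / real (card (cell_indices l)) ^ card J"
        using bounded_meas by (intro prob_no_crowded_cell_le[OF ind unif J(2,3)])
      then show False using J(4) by linarith
    qed
    then have "emeasure M (bounded C) = 0" for C by (simp add: emeasure_eq_measure)
    then have "emeasure M E = 0"
      unfolding E_eq using bounded_meas by (intro emeasure_UN_eq_0) auto
    then show ?thesis by (simp add: measure_def)
  qed
  ultimately show ?thesis using E_meas unfolding Let_def growth_def[symmetric] E_def[symmetric] by blast
qed

end
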